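(* Let $A\in\mathfrak{P}^{(k,\ell)}$ and $B\in\mathfrak{P}^{(k',\ell')}$ be polynomial poly-vector fields with decompositions $A=A_0+DA\wedge e^{(k,\ell)}$ and $B=B_0+DB\wedge e^{(k',\ell')}$, where $DA_0=0$, $DB_0=0$. Put $\Delta=k-\ell$, $\Delta'=k'-\ell'$, $k''=k+k'$, $\ell''=\ell+\ell'$, $\Delta''=\Delta+\Delta'=k''-\ell''$, and assume $n+\Delta$, $n+\Delta'$, $n+\Delta''$ are nonzero. Then, with $[A,B]_0:=[A,B]-D[A,B]\wedge e^{(k'',\ell'')}$, $$\begin{aligned} [A,B]_0=\ &[A_0,B_0]+\frac{\Delta'}{n+\Delta}DA\wedge B_0+(-1)^{\ell'}\frac{\Delta}{n+\Delta'}A_0\wedge DB\\ &+\frac{\Delta}{n+\Delta'}[A_0,DB]\wedge e^{(k'',\ell'')}-(-1)^{\ell'}\frac{\Delta'}{n+\Delta}[DA,B_0]\wedge e^{(k'',\ell'')} \end{aligned}$$ and $$\begin{aligned} D[A,B]=\ &[A_0,DB]-(-1)^{\ell'}[DA,B_0]\\ &-\frac{(n+\Delta'')(\Delta-\Delta')}{(n+\Delta)(n+\Delta')}\Big(DA\wedge DB+(-1)^{\ell'}[DA,DB]\wedge e^{(k'',\ell'')}\Big). \end{aligned}$$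
   Context: Let $V=\mathbb{R}^n$ with linear coordinates $x^1,\dots,x^n$ and $\partial_i=\partial/\partial x^i$. $\mathfrak{P}^{(k,\ell)}\cong S^k(V^* )\otimes\Lambda^\ell V$ denotes the space of $\ell$-vector fields on $V$ whose coefficients are homogeneous polynomials of degree $k$ (zero if $k<0$, $\ell<0$ or $\ell>n$). The trace operator $D:\mathfrak{P}^{(k,\ell)}\to\mathfrak{P}^{(k-1,\ell-1)}$ is given, for $U=\frac1{\ell!}U^{j_1\ldots j_\ell}\partial_{j_1}\wedge\cdots\wedge\partial_{j_\ell}$, by $D(U)=\frac{1}{(\ell-1)!}\partial_mU^{j_1\ldots j_{\ell-1}m}\partial_{j_1}\wedge\cdots\wedge\partial_{j_{\ell-1}}$ (and $D=0$ on functions). $[\cdot,\cdot]$ is the Schouten bracket: the bilinear extension of the Lie bracket to poly-vector fields with $[X,U]=L_XU$ for vector fields $X$, $[f,g]=0$ for functions, $[U,W]=-(-1)^{(u-1)(w-1)}[W,U]$ and $[U,W\wedge Z]=[U,W]\wedge Z+(-1)^{(u-1)w}W\wedge[U,Z]$ for $U,W$ of degrees $u,w$. It maps $\mathfrak{P}^{(k,\ell)}\times\mathfrak{P}^{(k',\ell')}$ to $\mathfrak{P}^{(k+k'-1,\ell+\ell'-1)}$. Set $e^{(k,\ell)}=\frac{1}{n+k-\ell}e_0$ with $e_0=x^m\partial_m$ (sum over $m$), defined when $n+k-\ell\ne0$. Every $A\in\mathfrak{P}^{(k,\ell)}$ is uniquely $A=A_0+DA\wedge e^{(k,\ell)}$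 with $A_0$ trace free ($DA_0=0$); $A_0$ is the trace-free part. Note $e^{(k,\ell)}$ depends only on $k-\ell$, so $[A,B]_0$ is the trace-free part of $[A,B]$. *)

theory Defs
  imports "HOL-Analysis.Analysis" "HOL-Library.Function_Algebras"
begin

section \<open>Polynomial poly-vector fields on the coordinate space\<close>

text \<open>
  The coordinates of the space are indexed by a finite linearly ordered type, so its dimension is
  the cardinality of that type. A poly-vector field \<open>U\<close> is given by its coefficients in the basis
  of increasing wedge products: \<open>U {j\<^sub>1 < \<dots> < j\<^sub>l}\<close> is the coefficient function of
  \<open>\<partial>\<^bsub>j\<^sub>1\<^esub> \<and> \<dots> \<and> \<partial>\<^bsub>j\<^sub>l\<^esub>\<close>. Fields of mixed degree are allowed; functions live on the
  empty index set, vector fields on the singletons. Sum, difference and zero are the pointwise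
  ones.
\<close>

type_synonym 'n scalar_field = "real ^ 'n \<Rightarrow> real"
type_synonym 'n polyvec = "'n set \<Rightarrow> 'n scalar_field"

definition partial :: "'n::finite \<Rightarrow> 'n scalar_field \<Rightarrow> 'n scalar_field" where
  "partial i f x = frechet_derivative f (at x) (axis i 1)"

definition hom_poly :: "int \<Rightarrow> ('n::finite) scalar_field set" where
  "hom_poly k = {p. \<exists>c. \<forall>x. p x =
     (\<Sum>\<alpha> | int (\<Sum>i\<in>UNIV. \<alpha> i) = k. c \<alpha> * (\<Prod>i\<in>UNIV. (x $ i) ^ \<alpha> i))}"

text \<open>The empty sum makes \<open>hom_polyvec k l\<close> the zero space for \<open>k < 0\<close>; for \<open>l < 0\<close> and for \<open>l\<close>
  above the dimension there is no index set of cardinality \<open>l\<close>.\<close>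

definition hom_polyvec :: "int \<Rightarrow> int \<Rightarrow> ('n::finite) polyvec set" where
  "hom_polyvec k l = {U. \<forall>I. if int (card I) = l then U I \<in> hom_poly k else U I = 0}"

definition polyvecs :: "('n::finite) polyvec set" where
  "polyvecs = {U. \<forall>I. real_polynomial_function (U I)}"

definition polyvecs_deg :: "int \<Rightarrow> ('n::finite) polyvec set" where
  "polyvecs_deg l = {U \<in> polyvecs. \<forall>I. int (card I) \<noteq> l \<longrightarrow> U I = 0}"

definition pv_scale :: "real \<Rightarrow> 'n polyvec \<Rightarrow> 'n polyvec" (infixr \<open>*\<^sub>P\<close> 75) where
  "c *\<^sub>P U = (\<lambda>I x. c * U I x)"

text \<open>\<open>shuffle_sign I J\<close> is the sign in \<open>\<partial>\<^sub>I \<and> \<partial>\<^sub>J = \<plusminus> \<partial>\<^bsub>I \<union> J\<^esub>\<close> for disjoint \<open>I\<close> and \<open>J\<close>.\<close>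

definition shuffle_sign :: "'n::linorder set \<Rightarrow> 'n set \<Rightarrow> real" where
  "shuffle_sign I J = (\<Prod>i\<in>I. \<Prod>j\<in>J. if j < i then -1 else 1)"

definition wedge :: "'n::{finite,linorder} polyvec \<Rightarrow> 'n polyvec \<Rightarrow> 'n polyvec"
    (infixl \<open>\<and>\<^sub>P\<close> 70) where
  "U \<and>\<^sub>P W = (\<lambda>K x. \<Sum>I\<in>Pow K. shuffle_sign I (K - I) * U I x * W (K - I) x)"

fun inversions :: "'a::linorder list \<Rightarrow> nat" where
  "inversions [] = 0"
| "inversions (x # xs) = length (filter (\<lambda>y. y < x) xs) + inversions xs"

text \<open>The totally antisymmetric components \<open>U\<^bsup>j\<^sub>1\<dots>j\<^sub>l\<^esup>\<close>, for arbitrary index lists.\<close>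

definition component :: "'n::{finite,linorder} polyvec \<Rightarrow> 'n list \<Rightarrow> 'n scalar_field" where
  "component U js x = (if distinct js then (-1) ^ inversions js * U (set js) x else 0)"

text \<open>\<open>(D U)\<^bsup>j\<^sub>1\<dots>j\<^sub>l\<^esup> = \<Sum>\<^sub>m \<partial>\<^sub>m U\<^bsup>j\<^sub>1\<dots>j\<^sub>lm\<^esup>\<close>, read off at increasing indices.\<close>

definition trace_op :: "'n::{finite,linorder} polyvec \<Rightarrow> 'n polyvec" where
  "trace_op U = (\<lambda>I x. \<Sum>m\<in>UNIV. partial m (component U (sorted_list_of_set I @ [m])) x)"

text \<open>The Lie derivative of the contravariant tensor \<open>U\<close> along the vector field \<open>X\<close>:
  \<open>(L\<^sub>X U)\<^bsup>j\<^sub>1\<dots>j\<^sub>l\<^esup> = X\<^sup>m \<partial>\<^sub>m U\<^bsup>j\<^sub>1\<dots>j\<^sub>l\<^esup> - \<Sum>\<^sub>s (\<partial>\<^sub>m X\<^bsup>j\<^sub>s\<^esup>) U\<^bsup>j\<^sub>1\<dots>m\<dots>j\<^sub>l\<^esup>\<close>, with \<open>m\<close> in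
  position \<open>s\<close>.\<close>

definition lie :: "'n::{finite,linorder} polyvec \<Rightarrow> 'n polyvec \<Rightarrow> 'n polyvec" where
  "lie X U = (\<lambda>I x. (let js = sorted_list_of_set I in
     (\<Sum>m\<in>UNIV. X {m} x * partial m (U I) x)
     - (\<Sum>s<length js. \<Sum>m\<in>UNIV. partial m (X {js ! s}) x * component U (js[s := m]) x)))"

text \<open>The properties determine \<open>br\<close> on polynomial fields; its values elsewhere are irrelevant.\<close>

definition schouten_bracket ::
    "('n::{finite,linorder} polyvec \<Rightarrow> 'n polyvec \<Rightarrow> 'n polyvec) \<Rightarrow> bool" where
  "schouten_bracket br \<longleftrightarrow>
     (\<forall>U\<in>polyvecs. \<forall>V\<in>polyvecs. \<forall>W\<in>polyvecs. \<forall>a b.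
        br (a *\<^sub>P U + b *\<^sub>P V) W = a *\<^sub>P br U W + b *\<^sub>P br V W \<and>
        br W (a *\<^sub>P U + b *\<^sub>P V) = a *\<^sub>P br W U + b *\<^sub>P br W V) \<and>
     (\<forall>X\<in>polyvecs_deg 1. \<forall>U\<in>polyvecs. br X U = lie X U) \<and>
     (\<forall>f\<in>polyvecs_deg 0. \<forall>g\<in>polyvecs_deg 0. br f g = 0) \<and>
     (\<forall>u w. \<forall>U\<in>polyvecs_deg u. \<forall>W\<in>polyvecs_deg w.
        br U W = (- ((-1) powi ((u - 1) * (w - 1)))) *\<^sub>P br W U) \<and>
     (\<forall>u w z. \<forall>U\<in>polyvecs_deg u. \<forall>W\<in>polyvecs_deg w. \<forall>Z\<in>polyvecs_deg z.
        br U (W \<and>\<^sub>P Z) = br U W \<and>\<^sub>P Z + ((-1) powi ((u - 1) * w)) *\<^sub>P (W \<and>\<^sub>P br U Z))"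

definition euler_field :: "('n::finite) polyvec" where
  "euler_field = (\<lambda>I x. \<Sum>m\<in>UNIV. if I = {m} then x $ m else 0)"

definition e_field :: "int \<Rightarrow> int \<Rightarrow> ('n::finite) polyvec" where
  "e_field k l = (1 / real_of_int (int CARD('n) + k - l)) *\<^sub>P euler_field"

section \<open>Existence of the Schouten bracket\<close>

text \<open>An explicit coordinate formula satisfies all the characterising properties, so
  \<open>schouten_bracket\<close> is not vacuous.\<close>

lemma shuffle_sign_union_left:
  fixes I I' J :: "'n::{finite,linorder} set"
  assumes "I \<inter> I' = {}"
  shows "shuffle_sign (I \<union> I') J = shuffle_sign I J * shuffle_sign I' J"
  unfolding shuffle_sign_def using assms by (simp add: prod.union_disjoint)

lemma shuffle_sign_union_right:
  fixes I J J' :: "'n::{finite,linorder} set"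
  assumes "J \<inter> J' = {}"
  shows "shuffle_sign I (J \<union> J') = shuffle_sign I J * shuffle_sign I J'"
  unfolding shuffle_sign_def using assms by (simp add: prod.union_disjoint prod.distrib)

lemma shuffle_sign_empty [simp]: "shuffle_sign {} J = 1" "shuffle_sign I {} = 1"
  by (simp_all add: shuffle_sign_def)

lemma shuffle_sign_swap:
  fixes I J :: "'n::{finite,linorder} set"
  assumes "I \<inter> J = {}"
  shows "shuffle_sign I J * shuffle_sign J I = (-1) ^ (card I * card J)"
proof -
  have "shuffle_sign J I = (\<Prod>i\<in>I. \<Prod>j\<in>J. if i < j then -1 else 1)"
    unfolding shuffle_sign_def by (rule prod.swap)
  then have "shuffle_sign I J * shuffle_sign J I =
      (\<Prod>i\<in>I. \<Prod>j\<in>J. (if j < i then -1 else 1) * (if i < j then -1 else 1))"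
    by (simp add: shuffle_sign_def prod.distrib)
  also have "\<dots> = (\<Prod>i\<in>I. \<Prod>j\<in>J. -1)"
    using assms by (intro prod.cong refl) (auto simp: neq_iff)
  also have "\<dots> = (-1) ^ (card I * card J)"
    by (simp add: power_mult mult.commute flip: power_mult)
  finally show ?thesis .
qed

lemma shuffle_sign_sq [simp]:
  "shuffle_sign I J * shuffle_sign I J = 1"
  "shuffle_sign I J * (shuffle_sign I J * c) = c"
proof -
  show *: "shuffle_sign I J * shuffle_sign I J = 1"
    unfolding shuffle_sign_def by (simp flip: prod.distrib) (intro prod.neutral ballI, simp)
  then show "shuffle_sign I J * (shuffle_sign I J * c) = c"
    by (simp flip: mult.assoc)
qed

lemma pv_scale_apply: "(c *\<^sub>P U) I x = c * U I x"
  by (simp add: pv_scale_def)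

lemma pv_scale_scale [simp]: "a *\<^sub>P b *\<^sub>P U = (a * b) *\<^sub>P U"
  by (simp add: pv_scale_def mult.assoc)

lemma pv_scale_one [simp]: "1 *\<^sub>P U = U"
  by (simp add: pv_scale_def)

lemma pv_scale_add: "c *\<^sub>P (U + W) = c *\<^sub>P U + c *\<^sub>P W"
  by (intro ext) (simp add: pv_scale_def algebra_simps)

lemma sum_fun_apply: "(\<Sum>m\<in>S. f m) x = (\<Sum>m\<in>S. f m x)"
  by (induction S rule: infinite_finite_induct) auto

lemma pv_scale_sum: "c *\<^sub>P (\<Sum>m\<in>S. f m) = (\<Sum>m\<in>S. c *\<^sub>P f m)"
  by (intro ext) (simp add: pv_scale_def sum_fun_apply sum_distrib_left)

lemma wedge_apply:
  "(U \<and>\<^sub>P W) K x = (\<Sum>I\<in>Pow K. shuffle_sign I (K - I) * U I x * W (K - I) x)"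
  by (simp add: wedge_def)

lemma wedge_add_left: "(U + V) \<and>\<^sub>P W = U \<and>\<^sub>P W + V \<and>\<^sub>P W"
  by (intro ext) (simp add: wedge_apply algebra_simps sum.distrib)

lemma wedge_add_right: "W \<and>\<^sub>P (U + V) = W \<and>\<^sub>P U + W \<and>\<^sub>P V"
  by (intro ext) (simp add: wedge_apply algebra_simps sum.distrib)

lemma wedge_scale_left: "(c *\<^sub>P U) \<and>\<^sub>P W = c *\<^sub>P (U \<and>\<^sub>P W)"
  by (intro ext) (simp add: wedge_apply pv_scale_apply algebra_simps sum_distrib_left)

lemma wedge_scale_right: "U \<and>\<^sub>P (c *\<^sub>P W) = c *\<^sub>P (U \<and>\<^sub>P W)"
  by (intro ext) (simp add: wedge_apply pv_scale_apply algebra_simps sum_distrib_left)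

lemma wedge_sum_left: "(\<Sum>m\<in>S. f m) \<and>\<^sub>P W = (\<Sum>m\<in>S. f m \<and>\<^sub>P W)"
proof (induction S rule: infinite_finite_induct)
  case (insert x F)
  then show ?case by (simp only: sum.insert wedge_add_left simp_thms)
qed (auto simp: wedge_def zero_fun_def)

lemma wedge_sum_right: "W \<and>\<^sub>P (\<Sum>m\<in>S. f m) = (\<Sum>m\<in>S. W \<and>\<^sub>P f m)"
proof (induction S rule: infinite_finite_induct)
  case (insert x F)
  then show ?case by (simp only: sum.insert wedge_add_right simp_thms)
qed (auto simp: wedge_def zero_fun_def)

lemma wedge_assoc: "(U \<and>\<^sub>P W) \<and>\<^sub>P Z = U \<and>\<^sub>P (W \<and>\<^sub>P Z)"
proof (intro ext)
  fix K x
  have "((U \<and>\<^sub>P W) \<and>\<^sub>P Z) K x =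
     (\<Sum>L\<in>Pow K. \<Sum>I\<in>Pow L. shuffle_sign L (K - L) * shuffle_sign I (L - I)
        * U I x * W (L - I) x * Z (K - L) x)"
    by (simp add: wedge_apply sum_distrib_left sum_distrib_right mult_ac)
  also have "\<dots> = (\<Sum>(L,I)\<in>Sigma (Pow K) Pow. shuffle_sign L (K - L) * shuffle_sign I (L - I)
        * U I x * W (L - I) x * Z (K - L) x)"
    by (subst sum.Sigma) auto
  also have "\<dots> = (\<Sum>(I,J)\<in>Sigma (Pow K) (\<lambda>I. Pow (K - I)).
        shuffle_sign I (K - I) * shuffle_sign J (K - I - J) * U I x * W J x * Z (K - I - J) x)"
  proof (rule sum.reindex_bij_witness[of _ "\<lambda>(I,J). (I \<union> J, I)" "\<lambda>(L,I). (I, L - I)"],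
         goal_cases)
    case (5 a)
    obtain L I where a: "a = (L, I)" by (cases a)
    from 5 a have sub: "I \<subseteq> L" "L \<subseteq> K" by auto
    have 1: "K - I - (L - I) = K - L" "K - I = (L - I) \<union> (K - L)" "L = I \<union> (L - I)"
      using sub by auto
    have "shuffle_sign L (K - L) = shuffle_sign I (K - L) * shuffle_sign (L - I) (K - L)"
      by (subst 1(3), subst shuffle_sign_union_left) auto
    moreover have "shuffle_sign I (K - I) = shuffle_sign I (L - I) * shuffle_sign I (K - L)"
      by (subst 1(2), subst shuffle_sign_union_right) auto
    ultimately show ?case by (simp add: a 1(1))
  qed auto
  also have "\<dots> = (U \<and>\<^sub>P (W \<and>\<^sub>P Z)) K x"
    by (subst sum.Sigma [symmetric]) (auto simp: wedge_apply sum_distrib_left mult_ac)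
  finally show "((U \<and>\<^sub>P W) \<and>\<^sub>P Z) K x = (U \<and>\<^sub>P (W \<and>\<^sub>P Z)) K x" .
qed

definition pure_deg :: "int \<Rightarrow> 'n polyvec \<Rightarrow> bool" where
  "pure_deg u U \<longleftrightarrow> (\<forall>I. int (card I) \<noteq> u \<longrightarrow> U I = 0)"

lemma powi_parity: "(-1::real) powi a = (if even a then 1 else -1)"
  by (cases "even a") (auto simp: power_int_minus_left)

lemma wedge_commute:
  assumes "pure_deg u U" "pure_deg w W"
  shows "U \<and>\<^sub>P W = ((-1) powi (u * w)) *\<^sub>P (W \<and>\<^sub>P U)"
proof (intro ext)
  fix K x
  have "(U \<and>\<^sub>P W) K x = (\<Sum>J\<in>Pow K. shuffle_sign (K - J) J * U (K - J) x * W J x)"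
    unfolding wedge_apply
    by (rule sum.reindex_bij_witness[of _ "\<lambda>I. K - I" "\<lambda>I. K - I"]) (auto simp: double_diff)
  also have "\<dots> = (\<Sum>J\<in>Pow K. (-1) powi (u * w) * (shuffle_sign J (K - J) * W J x * U (K - J) x))"
  proof (intro sum.cong refl)
    fix J assume "J \<in> Pow K"
    show "shuffle_sign (K - J) J * U (K - J) x * W J x =
       (-1) powi (u * w) * (shuffle_sign J (K - J) * W J x * U (K - J) x)"
    proof (cases "int (card J) = w \<and> int (card (K - J)) = u")
      case True
      have "(-1::real) powi (u * w) = (-1) ^ (card (K - J) * card J)"
        using True by (auto simp: powi_parity)
      also have "\<dots> = shuffle_sign (K - J) J * shuffle_sign J (K - J)"
        by (subst shuffle_sign_swap) auto
      finally show ?thesis by (simp add: mult_ac)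
    next
      case False
      then have "W J x = 0 \<or> U (K - J) x = 0"
        using assms by (auto simp: pure_deg_def)
      then show ?thesis by auto
    qed
  qed
  also have "\<dots> = (((-1) powi (u * w)) *\<^sub>P (W \<and>\<^sub>P U)) K x"
    by (simp add: wedge_apply pv_scale_apply sum_distrib_left)
  finally show "(U \<and>\<^sub>P W) K x = (((-1) powi (u * w)) *\<^sub>P (W \<and>\<^sub>P U)) K x" .
qed

definition contract :: "'n::{finite,linorder} \<Rightarrow> 'n polyvec \<Rightarrow> 'n polyvec" where
  "contract m U = (\<lambda>I x. if m \<in> I then 0 else shuffle_sign I {m} * U (insert m I) x)"

lemma contract_add: "contract m (U + V) = contract m U + contract m V"
  by (intro ext) (simp add: contract_def algebra_simps)

lemma contract_scale: "contract m (c *\<^sub>P U) = c *\<^sub>P contract m U"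
  by (intro ext) (simp add: contract_def pv_scale_def algebra_simps)

lemma pure_contract:
  fixes U :: "'n::{finite,linorder} polyvec"
  shows "pure_deg u U \<Longrightarrow> pure_deg (u - 1) (contract m U)"
  unfolding pure_deg_def
proof (intro allI impI ext)
  fix I :: "'n set" and x assume *: "\<forall>I. int (card I) \<noteq> u \<longrightarrow> U I = 0" "int (card I) \<noteq> u - 1"
  show "contract m U I x = 0 x"
  proof (cases "m \<in> I")
    case False
    then have "card (insert m I) = Suc (card I)" by simp
    with * have "U (insert m I) = 0" by auto
    then show ?thesis by (simp add: contract_def)
  qed (simp add: contract_def)
qed

lemma contract_wedge:
  assumes W: "pure_deg w W"
  shows "contract m (U \<and>\<^sub>P W) = U \<and>\<^sub>P contract m W + ((-1) powi w) *\<^sub>P (contract m U \<and>\<^sub>P W)"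
proof (intro ext)
  fix K x
  have Wz: "W J x = 0" if "int (card J) \<noteq> w" for J
    using that W by (auto simp: pure_deg_def)
  show "contract m (U \<and>\<^sub>P W) K x =
    (U \<and>\<^sub>P contract m W + ((-1) powi w) *\<^sub>P (contract m U \<and>\<^sub>P W)) K x"
  proof (cases "m \<in> K")
    case False
    have inj: "inj_on (insert m) (Pow K)"
      using False by (intro inj_onI) (metis Pow_iff insert_ident subsetD)
    have disj: "Pow K \<inter> insert m ` Pow K = {}" using False by auto
    have "(U \<and>\<^sub>P W) (insert m K) x =
       (\<Sum>I\<in>Pow K. shuffle_sign I (insert m K - I) * U I x * W (insert m K - I) x) +
       (\<Sum>I\<in>Pow K. shuffle_sign (insert m I) (insert m K - insert m I) * U (insert m I) x
            * W (insert m K - insert m I) x)"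
      unfolding wedge_apply Pow_insert
      by (subst sum.union_disjoint) (auto simp: disj sum.reindex[OF inj])
    also have "\<dots> = shuffle_sign K {m} * ((\<Sum>I\<in>Pow K. shuffle_sign I (K - I) * U I x * contract m W (K - I) x) +
       (\<Sum>I\<in>Pow K. (-1) powi w * (shuffle_sign I (K - I) * contract m U I x * W (K - I) x)))"
      unfolding sum_distrib_left distrib_left
    proof (intro arg_cong2[of _ _ _ _ "(+)"] sum.cong refl)
      fix I assume I: "I \<in> Pow K"
      have m: "m \<notin> I" using I False by auto
      have e: "insert m K - I = (K - I) \<union> {m}" "K = I \<union> (K - I)" "insert m K - insert m I = K - I"
        "insert m I = I \<union> {m}"
        using I False by auto
      have s1: "shuffle_sign K {m} = shuffle_sign I {m} * shuffle_sign (K - I) {m}"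
        by (subst e(2), subst shuffle_sign_union_left) auto
      have s2: "shuffle_sign I (insert m K - I) = shuffle_sign I (K - I) * shuffle_sign I {m}"
        using False by (subst e(1), subst shuffle_sign_union_right) auto
      have s3: "shuffle_sign (insert m I) (K - I) = shuffle_sign I (K - I) * shuffle_sign {m} (K - I)"
        using m by (subst e(4), subst shuffle_sign_union_left) auto
      show "shuffle_sign I (insert m K - I) * U I x * W (insert m K - I) x =
        shuffle_sign K {m} * (shuffle_sign I (K - I) * U I x * contract m W (K - I) x)"
        unfolding s1 s2 using False e(1) by (simp add: contract_def mult_ac)
      show "shuffle_sign (insert m I) (insert m K - insert m I) * U (insert m I) x
            * W (insert m K - insert m I) x =
        shuffle_sign K {m} * ((-1) powi w * (shuffle_sign I (K - I) * contract m U I x * W (K - I) x))"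
      proof (cases "int (card (K - I)) = w")
        case True
        have "(-1::real) powi w = (-1) ^ (card {m} * card (K - I))"
          using True by (auto simp: powi_parity)
        also have "\<dots> = shuffle_sign {m} (K - I) * shuffle_sign (K - I) {m}"
          using False by (subst shuffle_sign_swap) auto
        finally show ?thesis
          unfolding s1 e(3) s3 using m by (simp add: contract_def mult_ac)
      next
        case False
        then show ?thesis using Wz e(3) by simp
      qed
    qed
    finally have "contract m (U \<and>\<^sub>P W) K x =
       (\<Sum>I\<in>Pow K. shuffle_sign I (K - I) * U I x * contract m W (K - I) x) +
       (\<Sum>I\<in>Pow K. (-1) powi w * (shuffle_sign I (K - I) * contract m U I x * W (K - I) x))"
      using False by (simp add: contract_def[of m "U \<and>\<^sub>P W"])
    then show ?thesis
      by (simp only: pv_scale_apply wedge_apply sum_distrib_left plus_fun_apply)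
  next
    case True
    define L where "L = K - {m}"
    have K: "K = insert m L" "m \<notin> L" using True by (auto simp: L_def)
    have inj: "inj_on (insert m) (Pow L)"
      using K by (intro inj_onI) (metis Pow_iff insert_ident subsetD)
    have disj: "Pow L \<inter> insert m ` Pow L = {}" using K by auto
    have split: "(\<Sum>I\<in>Pow K. f I) = (\<Sum>I\<in>Pow L. f I) + (\<Sum>I\<in>Pow L. f (insert m I))" for f :: "'a set \<Rightarrow> real"
      unfolding K(1) Pow_insert
      by (subst sum.union_disjoint) (auto simp: disj sum.reindex[OF inj])
    have a: "(U \<and>\<^sub>P contract m W) K x =
      (\<Sum>I\<in>Pow L. shuffle_sign (insert m I) (L - I) * U (insert m I) x * contract m W (L - I) x)"
      unfolding wedge_apply split
    proof -
      have "(\<Sum>I\<in>Pow L. shuffle_sign I (K - I) * U I x * contract m W (K - I) x) = 0"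
        using K by (intro sum.neutral) (auto simp: contract_def)
      moreover have "(\<Sum>I\<in>Pow L. shuffle_sign (insert m I) (K - insert m I) * U (insert m I) x
            * contract m W (K - insert m I) x) =
         (\<Sum>I\<in>Pow L. shuffle_sign (insert m I) (L - I) * U (insert m I) x * contract m W (L - I) x)"
      proof (intro sum.cong refl)
        fix I assume "I \<in> Pow L"
        then have "K - insert m I = L - I" using K by auto
        then show "shuffle_sign (insert m I) (K - insert m I) * U (insert m I) x
            * contract m W (K - insert m I) x =
            shuffle_sign (insert m I) (L - I) * U (insert m I) x * contract m W (L - I) x" by simp
      qed
      ultimately show "(\<Sum>I\<in>Pow L. shuffle_sign I (K - I) * U I x * contract m W (K - I) x) +
          (\<Sum>I\<in>Pow L. shuffle_sign (insert m I) (K - insert m I) * U (insert m I) x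
            * contract m W (K - insert m I) x) =
         (\<Sum>I\<in>Pow L. shuffle_sign (insert m I) (L - I) * U (insert m I) x * contract m W (L - I) x)"
        by simp
    qed
    have b: "(contract m U \<and>\<^sub>P W) K x =
      (\<Sum>I\<in>Pow L. shuffle_sign I (K - I) * contract m U I x * W (K - I) x)"
      unfolding wedge_apply split by (simp add: contract_def)
    have "(U \<and>\<^sub>P contract m W) K x = - ((-1) powi w * (contract m U \<and>\<^sub>P W) K x)"
      unfolding a b sum_distrib_left sum_negf[symmetric]
    proof (intro sum.cong refl)
      fix I assume I: "I \<in> Pow L"
      have m: "m \<notin> I" "m \<notin> L - I" using I K by auto
      have e: "K - I = (L - I) \<union> {m}" "insert m I = I \<union> {m}" using I K by auto
      have s2: "shuffle_sign I (K - I) = shuffle_sign I (L - I) * shuffle_sign I {m}"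
        using m by (subst e(1), subst shuffle_sign_union_right) auto
      have s3: "shuffle_sign (insert m I) (L - I) = shuffle_sign I (L - I) * shuffle_sign {m} (L - I)"
        using m by (subst e(2), subst shuffle_sign_union_left) auto
      show "shuffle_sign (insert m I) (L - I) * U (insert m I) x * contract m W (L - I) x =
         - ((-1) powi w * (shuffle_sign I (K - I) * contract m U I x * W (K - I) x))"
      proof (cases "int (card (K - I)) = w")
        case True
        have "card (K - I) = Suc (card (L - I))" using e(1) m by simp
        then have "(-1::real) powi w = - ((-1) ^ (card {m} * card (L - I)))"
          using True by (auto simp: powi_parity)
        also have "(-1::real) ^ (card {m} * card (L - I)) = shuffle_sign {m} (L - I) * shuffle_sign (L - I) {m}"
          using m by (subst shuffle_sign_swap) auto
        finally show ?thesis
          unfolding s2 s3 using m e by (simp add: contract_def mult_ac)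
      next
        case False
        then have "W (K - I) x = 0" by (rule Wz)
        then show ?thesis using e m by (simp add: contract_def)
      qed
    qed
    then show ?thesis using True by (simp add: contract_def[of m "U \<and>\<^sub>P W"] pv_scale_apply)
  qed
qed

lemma partial_has_derivative:
  "(f has_derivative f') (at x) \<Longrightarrow> partial i f x = f' (axis i 1)"
  by (metis frechet_derivative_at partial_def)

lemma partial_zero [simp]: "partial i 0 = 0"
proof
  fix x :: "real ^ 'a"
  have "((0 :: real ^ 'a \<Rightarrow> real) has_derivative (\<lambda>_. 0)) (at x)"
    unfolding zero_fun_def by (rule has_derivative_const)
  from partial_has_derivative[OF this] show "partial i 0 x = 0 x" by simp
qed

definition pdiff :: "'n::{finite,linorder} \<Rightarrow> 'n polyvec \<Rightarrow> 'n polyvec" where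
  "pdiff m U = (\<lambda>I. partial m (U I))"

lemma pure_pdiff: "pure_deg u U \<Longrightarrow> pure_deg u (pdiff m U)"
  by (simp add: pure_deg_def pdiff_def)

lemma polyvecs_has_derivative:
  "U \<in> polyvecs \<Longrightarrow> (U I has_derivative frechet_derivative (U I) (at x)) (at x)"
  unfolding polyvecs_def
  using differentiable_at_real_polynomial_function frechet_derivative_works by blast

lemma pdiff_linear:
  assumes "U \<in> polyvecs" "V \<in> polyvecs"
  shows "pdiff m (a *\<^sub>P U + b *\<^sub>P V) = a *\<^sub>P pdiff m U + b *\<^sub>P pdiff m V"
proof (intro ext)
  fix I x
  have "((\<lambda>x. a * U I x + b * V I x) has_derivative
     (\<lambda>h. a * frechet_derivative (U I) (at x) h + b * frechet_derivative (V I) (at x) h)) (at x)"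
    by (intro derivative_intros polyvecs_has_derivative assms)
  from partial_has_derivative[OF this, of m]
  show "pdiff m (a *\<^sub>P U + b *\<^sub>P V) I x = (a *\<^sub>P pdiff m U + b *\<^sub>P pdiff m V) I x"
    by (simp add: pdiff_def pv_scale_def partial_def plus_fun_def)
qed

lemma pdiff_wedge:
  assumes "U \<in> polyvecs" "V \<in> polyvecs"
  shows "pdiff m (U \<and>\<^sub>P V) = pdiff m U \<and>\<^sub>P V + U \<and>\<^sub>P pdiff m V"
proof (intro ext)
  fix K x
  have "((\<lambda>x. \<Sum>I\<in>Pow K. shuffle_sign I (K - I) * U I x * V (K - I) x) has_derivative
     (\<lambda>h. \<Sum>I\<in>Pow K. shuffle_sign I (K - I) * U I x * frechet_derivative (V (K - I)) (at x) h
        + shuffle_sign I (K - I) * frechet_derivative (U I) (at x) h * V (K - I) x)) (at x)"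
    by (intro has_derivative_sum has_derivative_mult has_derivative_mult_right
          polyvecs_has_derivative assms)
  from partial_has_derivative[OF this, of m]
  show "pdiff m (U \<and>\<^sub>P V) K x = (pdiff m U \<and>\<^sub>P V + U \<and>\<^sub>P pdiff m V) K x"
    by (simp add: pdiff_def wedge_def partial_def plus_fun_def sum.distrib add.commute)
qed

definition grade_inv :: "'n polyvec \<Rightarrow> 'n polyvec" where
  "grade_inv W = (\<lambda>I x. (-1) ^ card I * W I x)"

lemma grade_inv_pure: "pure_deg w W \<Longrightarrow> grade_inv W = ((-1) powi w) *\<^sub>P W"
  unfolding pure_deg_def grade_inv_def pv_scale_def
  by (intro ext) (metis mult_zero_right power_int_of_nat zero_fun_apply)

definition schouten_formula :: "'n::{finite,linorder} polyvec \<Rightarrow> 'n polyvec \<Rightarrow> 'n polyvec" where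
  "schouten_formula U W = (\<Sum>m\<in>UNIV. contract m U \<and>\<^sub>P pdiff m W + pdiff m U \<and>\<^sub>P contract m (grade_inv W))"

lemma schouten_formula_pure:
  assumes "pure_deg w W"
  shows "schouten_formula U W = (\<Sum>m\<in>UNIV. contract m U \<and>\<^sub>P pdiff m W + ((-1) powi w) *\<^sub>P (pdiff m U \<and>\<^sub>P contract m W))"
  unfolding schouten_formula_def grade_inv_pure[OF assms] contract_scale wedge_scale_right ..

lemma grade_inv_linear: "grade_inv (a *\<^sub>P U + b *\<^sub>P V) = a *\<^sub>P grade_inv U + b *\<^sub>P grade_inv V"
  by (intro ext) (simp add: grade_inv_def pv_scale_def algebra_simps)

lemma schouten_formula_linear:
  assumes "U \<in> polyvecs" "V \<in> polyvecs"
  shows "schouten_formula (a *\<^sub>P U + b *\<^sub>P V) W = a *\<^sub>P schouten_formula U W + b *\<^sub>P schouten_formula V W"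
    and "schouten_formula W (a *\<^sub>P U + b *\<^sub>P V) = a *\<^sub>P schouten_formula W U + b *\<^sub>P schouten_formula W V"
  unfolding schouten_formula_def pdiff_linear[OF assms] grade_inv_linear contract_add contract_scale
    wedge_add_left wedge_add_right wedge_scale_left wedge_scale_right
  by (simp_all add: pv_scale_sum pv_scale_add sum.distrib add_ac)

lemma schouten_formula_antisym:
  assumes "pure_deg u U" "pure_deg w W"
  shows "schouten_formula U W = (- ((-1) powi ((u - 1) * (w - 1)))) *\<^sub>P schouten_formula W U"
  unfolding schouten_formula_pure[OF assms(1)] schouten_formula_pure[OF assms(2)] pv_scale_sum pv_scale_add pv_scale_scale
proof (intro sum.cong refl)
  fix m
  have 1: "contract m U \<and>\<^sub>P pdiff m W = ((-1) powi ((u - 1) * w)) *\<^sub>P (pdiff m W \<and>\<^sub>P contract m U)"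
    by (intro wedge_commute pure_contract pure_pdiff assms)
  have 2: "pdiff m U \<and>\<^sub>P contract m W = ((-1) powi (u * (w - 1))) *\<^sub>P (contract m W \<and>\<^sub>P pdiff m U)"
    by (intro wedge_commute pure_contract pure_pdiff assms)
  show "contract m U \<and>\<^sub>P pdiff m W + ((-1) powi w) *\<^sub>P (pdiff m U \<and>\<^sub>P contract m W) =
     (- ((-1) powi ((u - 1) * (w - 1)))) *\<^sub>P (contract m W \<and>\<^sub>P pdiff m U) +
     (- ((-1) powi ((u - 1) * (w - 1))) * (-1) powi u) *\<^sub>P (pdiff m W \<and>\<^sub>P contract m U)"
    unfolding 1 2 pv_scale_scale
    by (subst add.commute, intro arg_cong2[of _ _ _ _ "(+)"] arg_cong2[of _ _ _ _ pv_scale] refl)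
       (auto simp: powi_parity)
qed

lemma pure_wedge:
  fixes U W :: "'n::{finite,linorder} polyvec"
  assumes "pure_deg u U" "pure_deg w W"
  shows "pure_deg (u + w) (U \<and>\<^sub>P W)"
  unfolding pure_deg_def
proof (intro allI impI ext)
  fix K :: "'n set" and x assume K: "int (card K) \<noteq> u + w"
  show "(U \<and>\<^sub>P W) K x = 0 x"
    unfolding wedge_apply
  proof (simp, intro sum.neutral ballI)
    fix I assume I: "I \<in> Pow K"
    then have "card K = card I + card (K - I)"
      by (metis Pow_iff card_Diff_subset card_mono finite le_add_diff_inverse)
    with K have "int (card I) \<noteq> u \<or> int (card (K - I)) \<noteq> w" by auto
    then have "U I x = 0 \<or> W (K - I) x = 0" using assms by (auto simp: pure_deg_def)
    then show "shuffle_sign I (K - I) * U I x * W (K - I) x = 0" by auto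
  qed
qed

lemma schouten_formula_leibniz:
  assumes U: "pure_deg u U" and W: "pure_deg w W" and Z: "pure_deg z Z"
    and p: "W \<in> polyvecs" "Z \<in> polyvecs"
  shows "schouten_formula U (W \<and>\<^sub>P Z) = schouten_formula U W \<and>\<^sub>P Z + ((-1) powi ((u - 1) * w)) *\<^sub>P (W \<and>\<^sub>P schouten_formula U Z)"
  unfolding schouten_formula_pure[OF W] schouten_formula_pure[OF Z] schouten_formula_pure[OF pure_wedge[OF W Z]]
    wedge_sum_left wedge_sum_right pv_scale_sum sum.distrib[symmetric]
proof (intro sum.cong refl)
  fix m
  have 1: "W \<and>\<^sub>P (contract m U \<and>\<^sub>P Y) =
      ((-1) powi ((u - 1) * w)) *\<^sub>P (contract m U \<and>\<^sub>P (W \<and>\<^sub>P Y))" for Y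
    using wedge_commute[OF W pure_contract[OF U]]
    by (simp add: wedge_assoc[symmetric] wedge_scale_left mult.commute)
  have 2: "W \<and>\<^sub>P (pdiff m U \<and>\<^sub>P Y) =
      ((-1) powi (u * w)) *\<^sub>P (pdiff m U \<and>\<^sub>P (W \<and>\<^sub>P Y))" for Y
    using wedge_commute[OF W pure_pdiff[OF U]]
    by (simp add: wedge_assoc[symmetric] wedge_scale_left mult.commute)
  show "contract m U \<and>\<^sub>P pdiff m (W \<and>\<^sub>P Z) + ((-1) powi (w + z)) *\<^sub>P (pdiff m U \<and>\<^sub>P contract m (W \<and>\<^sub>P Z)) =
     (contract m U \<and>\<^sub>P pdiff m W + ((-1) powi w) *\<^sub>P (pdiff m U \<and>\<^sub>P contract m W)) \<and>\<^sub>P Z +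
     ((-1) powi ((u - 1) * w)) *\<^sub>P
       (W \<and>\<^sub>P (contract m U \<and>\<^sub>P pdiff m Z + ((-1) powi z) *\<^sub>P (pdiff m U \<and>\<^sub>P contract m Z)))"
    unfolding pdiff_wedge[OF p] contract_wedge[OF Z] wedge_add_left wedge_add_right
      wedge_scale_left wedge_scale_right pv_scale_add pv_scale_scale wedge_assoc 1 2
    by (intro ext) (auto simp: pv_scale_def powi_parity)
qed

lemma schouten_formula_functions:
  assumes "pure_deg 0 f" "pure_deg 0 g"
  shows "schouten_formula f g = 0"
proof -
  have c: "contract m h = 0" if "pure_deg 0 h" for m :: 'a and h
    using that unfolding pure_deg_def contract_def by (intro ext) auto
  show ?thesis unfolding schouten_formula_pure[OF assms(2)] c[OF assms(1)] c[OF assms(2)]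
    by (intro ext) (simp add: wedge_def pv_scale_def sum_fun_apply)
qed

lemma inversions_swap:
  assumes "a \<noteq> b"
  shows "(-1 :: real) ^ inversions (xs @ a # b # ys) = - ((-1) ^ inversions (xs @ b # a # ys))"
  using assms by (induction xs) (auto simp: power_add)

lemma component_swap: "component U (xs @ a # b # ys) x = - component U (xs @ b # a # ys) x"
  using inversions_swap[of a b xs ys] by (auto simp: component_def insert_commute)

lemma component_move: "component U (xs @ m # ys) x = (-1) ^ length ys * component U (xs @ ys @ [m]) x"
proof (induction ys arbitrary: xs)
  case (Cons y ys)
  show ?case using component_swap[of U xs m y ys x] Cons[of "xs @ [y]"] by simp
qed simp

lemma inversions_snoc: "inversions (xs @ [m]) = inversions xs + length (filter (\<lambda>y. m < y) xs)"
  by (induction xs) auto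

lemma inversions_sorted: "sorted xs \<Longrightarrow> inversions xs = 0"
  by (induction xs) (auto simp: filter_empty_conv)

lemma power_filter_prod:
  "distinct xs \<Longrightarrow> (-1 :: real) ^ length (filter P xs) = (\<Prod>y\<in>set xs. if P y then -1 else 1)"
  by (induction xs) auto

lemma component_snoc:
  assumes "sorted js" "distinct js"
  shows "component U (js @ [m]) x = contract m U (set js) x"
  using assms
  by (simp add: component_def contract_def inversions_snoc inversions_sorted power_filter_prod
      shuffle_sign_def)

lemma schouten_formula_lie:
  fixes X U :: "'n::{finite,linorder} polyvec"
  assumes X: "pure_deg 1 X"
  shows "schouten_formula X U = lie X U"
proof (intro ext)
  fix I :: "'n set" and x
  define js where "js = sorted_list_of_set I"
  have js: "sorted js" "distinct js" "set js = I" by (simp_all add: js_def)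
  have X0: "X J = 0" if "card J \<noteq> 1" for J using X that by (auto simp: pure_deg_def)
  have c0: "contract m X J x = 0" if "J \<noteq> {}" for m J
  proof (cases "m \<in> J")
    case False
    moreover have "card J \<noteq> 0" using that by simp
    ultimately have "card (insert m J) \<noteq> 1" by simp
    from X0[OF this] show ?thesis by (simp add: contract_def)
  qed (simp add: contract_def)
  have 1: "(contract m X \<and>\<^sub>P pdiff m U) I x = X {m} x * partial m (U I) x" for m
  proof -
    have "(contract m X \<and>\<^sub>P pdiff m U) I x =
       (\<Sum>J\<in>{{}}. shuffle_sign J (I - J) * contract m X J x * pdiff m U (I - J) x)"
      unfolding wedge_apply by (rule sum.mono_neutral_right) (auto simp: c0)
    then show ?thesis by (simp add: contract_def pdiff_def)
  qed
  have 2: "(pdiff m X \<and>\<^sub>P contract m (grade_inv U)) I x =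
      - (\<Sum>s<length js. partial m (X {js ! s}) x * component U (js[s := m]) x)" for m
  proof -
    let ?f = "\<lambda>J. shuffle_sign J (I - J) * pdiff m X J x * contract m (grade_inv U) (I - J) x"
    have "(pdiff m X \<and>\<^sub>P contract m (grade_inv U)) I x = (\<Sum>J\<in>(\<lambda>i. {i}) ` I. ?f J)"
      unfolding wedge_apply
    proof (rule sum.mono_neutral_right)
      show "\<forall>J\<in>Pow I - (\<lambda>i. {i}) ` I. ?f J = 0"
      proof
        fix J assume J: "J \<in> Pow I - (\<lambda>i. {i}) ` I"
        have "card J \<noteq> 1"
        proof
          assume "card J = 1"
          then obtain i where "J = {i}" by (auto simp: card_1_singleton_iff)
          with J show False by auto
        qed
        from X0[OF this] show "?f J = 0" by (simp add: pdiff_def)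
      qed
    qed auto
    also have "\<dots> = (\<Sum>i\<in>I. ?f {i})"
      by (subst sum.reindex) (auto intro: inj_onI)
    also have "\<dots> = (\<Sum>s<length js. ?f {js ! s})"
    proof (rule sum.reindex_bij_betw[symmetric])
      show "bij_betw ((!) js) {..<length js} I"
        using js by (auto intro: bij_betw_nth)
    qed
    also have "\<dots> = (\<Sum>s<length js. - (partial m (X {js ! s}) x * component U (js[s := m]) x))"
    proof (intro sum.cong refl)
      fix s assume "s \<in> {..<length js}"
      then have s: "s < length js" by simp
      define xs i ys where "xs = take s js" and "i = js ! s" and "ys = drop (Suc s) js"
      have split: "js = xs @ i # ys" using s by (simp add: xs_def i_def ys_def id_take_nth_drop)
      have upd: "js[s := m] = xs @ m # ys" using s by (simp add: xs_def ys_def upd_conv_take_nth_drop)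
      have I: "I - {i} = set (xs @ ys)" and so: "sorted (xs @ ys)" and di: "distinct (xs @ ys)"
        using js unfolding split by (auto simp: sorted_append)
      have lt: "\<And>y. y \<in> set xs \<Longrightarrow> y < i" "\<And>y. y \<in> set ys \<Longrightarrow> i < y"
        using js(1,2) unfolding split by (auto simp: sorted_append order.strict_iff_order)
      have "shuffle_sign {i} (I - {i}) = (-1) ^ length (filter (\<lambda>y. y < i) (xs @ ys))"
        unfolding I power_filter_prod[OF di] by (simp add: shuffle_sign_def)
      also have "filter (\<lambda>y. y < i) (xs @ ys) = xs"
        using lt by (auto simp: filter_empty_conv filter_id_conv dest: lt(2)[THEN less_asym])
      finally have sg: "shuffle_sign {i} (I - {i}) = (-1) ^ length xs" .
      have "i \<in> I" using js split by auto
      have card: "card I = Suc (length xs + length ys)"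
        using js(2,3) distinct_card[OF js(2)] unfolding split by auto
      have cI: "card (insert m (I - {i})) = card I" if "m \<notin> I - {i}"
        using that \<open>i \<in> I\<close> card by simp
      have "contract m (grade_inv U) (I - {i}) x = (-1) ^ card I * contract m U (I - {i}) x"
        using cI by (auto simp: contract_def grade_inv_def)
      also have "contract m U (I - {i}) x = component U (xs @ ys @ [m]) x"
        using component_snoc[OF so di, of U m x] unfolding I by simp
      also have "component U (xs @ ys @ [m]) x = (-1) ^ length ys * component U (js[s := m]) x"
        unfolding upd component_move[of U xs m ys] by (simp flip: power_add mult.assoc)
      finally have "?f {i} = (-1) ^ length xs * partial m (X {i}) x *
         ((-1) ^ card I * ((-1) ^ length ys * component U (js[s := m]) x))"
        by (simp add: sg pdiff_def)
      also have "\<dots> = - (partial m (X {i}) x * component U (js[s := m]) x)"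
        unfolding card by (cases "even (length xs)"; cases "even (length ys)") auto
      finally show "?f {js ! s} = - (partial m (X {js ! s}) x * component U (js[s := m]) x)"
        by (simp add: i_def)
    qed
    finally show ?thesis by (simp add: sum_negf)
  qed
  have "schouten_formula X U I x = (\<Sum>m\<in>UNIV. X {m} x * partial m (U I) x)
     - (\<Sum>m\<in>UNIV. \<Sum>s<length js. partial m (X {js ! s}) x * component U (js[s := m]) x)"
    unfolding schouten_formula_def by (simp add: sum_fun_apply 1 2 sum.distrib sum_negf sum_subtractf)
  also have "\<dots> = lie X U I x"
    unfolding lie_def Let_def js_def[symmetric] by (subst (2) sum.swap) simp
  finally show "schouten_formula X U I x = lie X U I x" .
qed

lemma polyvecs_deg_pure: "U \<in> polyvecs_deg u \<Longrightarrow> U \<in> polyvecs \<and> pure_deg u U"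
  by (simp add: polyvecs_deg_def pure_deg_def)

theorem schouten_bracket_exists:
  "\<exists>br :: 'n::{finite,linorder} polyvec \<Rightarrow> 'n polyvec \<Rightarrow> 'n polyvec. schouten_bracket br"
proof
  show "schouten_bracket (schouten_formula :: 'n polyvec \<Rightarrow> _)"
    unfolding schouten_bracket_def
    by (intro conjI allI ballI)
       (auto dest!: polyvecs_deg_pure intro: schouten_formula_linear schouten_formula_lie schouten_formula_functions schouten_formula_antisym schouten_formula_leibniz)
qed

end

theory Submission
  imports Defs
begin

text \<open>
  Write \<open>[U, W]\<close> for the bracket, \<open>D\<close> for the trace, \<open>e\<^sub>0\<close> for the Euler field, and \<open>w\<close> for the
  degree of \<open>W\<close>. The trace is a second-order operator of Laplace type on the algebra of
  poly-vector fields, and the Schouten bracket measures its failure to be a derivation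
  (\<open>trace_wedge\<close>):
  \<open>D (U \<and> W) = U \<and> D W + (-1)\<^sup>w (D U \<and> W + [U, W])\<close>. Since \<open>D\<close> squares to zero
  (\<open>trace_trace\<close>), applying \<open>D\<close> to this identity shows that \<open>D\<close> is a derivation of the bracket
  (\<open>trace_schouten_formula\<close>): \<open>D [U, W] = [U, D W] - (-1)\<^sup>w [D U, W]\<close>.

  On a field with coefficients of degree \<open>k\<close> and with \<open>l\<close> indices the Euler field acts by
  \<open>[e\<^sub>0, U] = (k - l) U\<close>. Because \<open>D e\<^sub>0\<close> is constant, the derivation property makes \<open>D\<close> preserve
  this eigenvalue, so \<open>A\<close>, \<open>D A\<close> and \<open>A\<^sub>0\<close> all have the eigenvalue \<open>\<Delta>\<close>, and \<open>B\<close>, \<open>D B\<close> and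
  \<open>B\<^sub>0\<close> the eigenvalue \<open>\<Delta>'\<close>. The Leibniz rule then evaluates every bracket with a factor \<open>e\<^sub>0\<close>
  (\<open>schouten_formula_wedge_euler_right\<close>, \<open>_left\<close> and \<open>_both\<close>). Inserting \<open>A = A\<^sub>0 + D A \<and> e\<close> and
  \<open>B = B\<^sub>0 + D B \<and> e\<close> into \<open>[A, B]\<close> and into \<open>[A, D B] - (-1)\<^sup>l\<^sup>' [D A, B]\<close> gives both claims
  after comparing rational coefficients; the terms \<open>D A \<and> D B \<and> e\<close> cancel in the trace-free part.

  All of this is computed with the coordinate expression \<open>schouten_formula\<close>. It may replace any
  bracket with the characterising properties because these leave no freedom on polynomial fields
  (\<open>schouten_bracket_unique\<close>): every field of positive degree is a sum of products with
  coordinate vector fields, so the Leibniz rule reduces the bracket to functions and vector fields.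
\<close>

section \<open>Partial derivatives of polynomials\<close>

lemma real_polynomial_has_derivative:
  "real_polynomial_function p \<Longrightarrow> (p has_derivative frechet_derivative p (at x)) (at x)"
  using differentiable_at_real_polynomial_function frechet_derivative_works by blast

lemma partial_add:
  assumes "real_polynomial_function f" "real_polynomial_function g"
  shows "partial m (\<lambda>x. f x + g x) = (\<lambda>x. partial m f x + partial m g x)"
proof
  fix x
  from partial_has_derivative[OF has_derivative_add[OF
        assms[THEN real_polynomial_has_derivative, of x]], of m]
  show "partial m (\<lambda>x. f x + g x) x = partial m f x + partial m g x"
    by (simp add: partial_def)
qed

lemma partial_mult:
  assumes "real_polynomial_function f" "real_polynomial_function g"
  shows "partial m (\<lambda>x. f x * g x) = (\<lambda>x. f x * partial m g x + partial m f x * g x)"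
proof
  fix x
  from partial_has_derivative[OF has_derivative_mult[OF
        assms[THEN real_polynomial_has_derivative, of x]], of m]
  show "partial m (\<lambda>x. f x * g x) x = f x * partial m g x + partial m f x * g x"
    by (simp add: partial_def)
qed

lemma partial_const: "partial m (\<lambda>x. c) = (\<lambda>x. 0)"
  using partial_has_derivative[OF has_derivative_const] by fastforce

lemma partial_linear: "bounded_linear f \<Longrightarrow> partial m f = (\<lambda>x. f (axis m 1))"
  using partial_has_derivative[OF bounded_linear_imp_has_derivative] by fastforce

lemma real_polynomial_partial:
  "real_polynomial_function p \<Longrightarrow> real_polynomial_function (partial m p)"
  by (induction rule: real_polynomial_function.induct)
     (auto simp: partial_add partial_mult partial_const partial_linear)

lemma partial_commute:
  "real_polynomial_function p \<Longrightarrow> partial m (partial k p) = partial k (partial m p)"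
proof (induction rule: real_polynomial_function.induct)
  case (add f g)
  then show ?case by (simp add: partial_add real_polynomial_partial)
next
  case (mult f g)
  then show ?case
    by (simp add: partial_add partial_mult real_polynomial_partial real_polynomial_function.intros(4)
        algebra_simps)
qed (simp_all add: partial_linear partial_const)

lemma partial_scale:
  assumes "real_polynomial_function f"
  shows "partial m (\<lambda>x. c * f x) = (\<lambda>x. c * partial m f x)"
  using partial_mult[OF real_polynomial_function.intros(2)[of c] assms] by (simp add: partial_const)

lemma hom_poly_polynomial:
  fixes p :: "'n::finite scalar_field"
  assumes "p \<in> hom_poly k"
  shows "real_polynomial_function p"
proof -
  from assms obtain c where c: "\<And>x. p x =
     (\<Sum>\<alpha> | int (\<Sum>i\<in>UNIV. \<alpha> i) = k. c \<alpha> * (\<Prod>i\<in>UNIV. (x $ i) ^ \<alpha> i))"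
    unfolding hom_poly_def by blast
  let ?S = "{\<alpha> :: 'n \<Rightarrow> nat. int (\<Sum>i\<in>UNIV. \<alpha> i) = k}"
  have mono: "real_polynomial_function (\<lambda>x::real^'n. c \<alpha> * (\<Prod>i\<in>UNIV. (x $ i) ^ \<alpha> i))" for \<alpha>
    by (intro real_polynomial_function.intros(4) real_polynomial_function.intros(2)
        real_polynomial_function_prod real_polynomial_function_power
        real_polynomial_function.intros(1) bounded_linear_vec_nth finite)
  show ?thesis
  proof (cases "finite ?S")
    case True
    have "p = (\<lambda>x. \<Sum>\<alpha>\<in>?S. c \<alpha> * (\<Prod>i\<in>UNIV. (x $ i) ^ \<alpha> i))" using c by auto
    then show ?thesis using real_polynomial_function_sum[OF True mono] by simp
  next
    case False
    then have "p = (\<lambda>x. 0)" using c by auto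
    then show ?thesis by auto
  qed
qed

text \<open>Euler's identity: differentiate \<open>p (t x) = t\<^sup>k p x\<close> at \<open>t = 1\<close>.\<close>

lemma hom_poly_euler:
  fixes p :: "'n::finite scalar_field"
  assumes "p \<in> hom_poly k"
  shows "(\<Sum>m\<in>UNIV. x $ m * partial m p x) = of_int k * p x"
proof -
  from assms obtain c where c: "\<And>x. p x =
     (\<Sum>\<alpha> | int (\<Sum>i\<in>UNIV. \<alpha> i) = k. c \<alpha> * (\<Prod>i\<in>UNIV. (x $ i) ^ \<alpha> i))"
    unfolding hom_poly_def by blast
  have scaling: "p (t *\<^sub>R x) = t ^ nat k * p x" for t
    unfolding c sum_distrib_left
  proof (intro sum.cong refl)
    fix \<alpha> :: "'n \<Rightarrow> nat"
    assume "\<alpha> \<in> {\<alpha>. int (\<Sum>i\<in>UNIV. \<alpha> i) = k}"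
    then have "nat k = (\<Sum>i\<in>UNIV. \<alpha> i)"
      unfolding mem_Collect_eq by (metis nat_int)
    then show "c \<alpha> * (\<Prod>i\<in>UNIV. ((t *\<^sub>R x) $ i) ^ \<alpha> i) =
        t ^ nat k * (c \<alpha> * (\<Prod>i\<in>UNIV. (x $ i) ^ \<alpha> i))"
      by (simp add: power_mult_distrib prod.distrib power_sum)
  qed
  have neg: "p x = 0" if "k < 0"
  proof -
    have "{\<alpha> :: 'n \<Rightarrow> nat. int (\<Sum>i\<in>UNIV. \<alpha> i) = k} = {}"
      using that by (metis (mono_tags, lifting) Collect_empty_eq linorder_not_less of_nat_0_le_iff)
    then show ?thesis by (simp add: c)
  qed
  let ?d = "frechet_derivative p (at x)"
  have d: "(p has_derivative ?d) (at x)"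
    by (rule real_polynomial_has_derivative[OF hom_poly_polynomial[OF assms]])
  then have lin: "linear ?d" by (rule has_derivative_linear)
  have "(\<Sum>m\<in>UNIV. x $ m * partial m p x) = ?d (\<Sum>m\<in>UNIV. (x $ m) *\<^sub>R axis m 1)"
    by (simp add: partial_def linear_sum[OF lin] linear_scale[OF lin])
  also have "(\<Sum>m\<in>UNIV. (x $ m) *\<^sub>R axis m 1) = x"
    using basis_expansion[of x] by (simp add: scalar_mult_eq_scaleR)
  finally have sum: "(\<Sum>m\<in>UNIV. x $ m * partial m p x) = ?d x" .
  have "((\<lambda>t. t *\<^sub>R x) has_derivative (\<lambda>h. h *\<^sub>R x)) (at 1)"
    by (auto intro!: derivative_eq_intros)
  then have "((\<lambda>t. p (t *\<^sub>R x)) has_derivative (\<lambda>h. ?d (h *\<^sub>R x))) (at 1)"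
    by (rule has_derivative_compose) (simp add: d)
  moreover have "((\<lambda>t. t ^ nat k * p x) has_derivative (\<lambda>h. real (nat k) * h * p x)) (at 1)"
    by (auto intro!: derivative_eq_intros)
  ultimately have "(\<lambda>h. ?d (h *\<^sub>R x)) = (\<lambda>h. real (nat k) * h * p x)"
    unfolding scaling by (rule has_derivative_unique)
  from fun_cong[OF this, of 1] have "?d x = real (nat k) * p x" by simp
  with sum neg show ?thesis by (cases "k < 0") auto
qed

section \<open>The algebra of polynomial fields\<close>

lemma polyvecs_degI: "U \<in> polyvecs \<Longrightarrow> pure_deg u U \<Longrightarrow> U \<in> polyvecs_deg u"
  by (simp add: polyvecs_deg_def pure_deg_def)

lemma polyvecs_deg_polyvecs: "U \<in> polyvecs_deg u \<Longrightarrow> U \<in> polyvecs"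
  by (simp add: polyvecs_deg_def)

lemma polyvecs_deg_pure_deg: "U \<in> polyvecs_deg u \<Longrightarrow> pure_deg u U"
  by (simp add: polyvecs_deg_def pure_deg_def)

lemma polyvecs_real_polynomial: "U \<in> polyvecs \<Longrightarrow> real_polynomial_function (U I)"
  by (simp add: polyvecs_def)

lemma polyvecs_add: "U \<in> polyvecs \<Longrightarrow> V \<in> polyvecs \<Longrightarrow> U + V \<in> polyvecs"
  unfolding polyvecs_def by (auto simp: plus_fun_def)

lemma polyvecs_scale: "U \<in> polyvecs \<Longrightarrow> c *\<^sub>P U \<in> polyvecs"
  unfolding polyvecs_def pv_scale_def by auto

lemma polyvecs_zero: "0 \<in> polyvecs"
  unfolding polyvecs_def zero_fun_def by auto

lemma polyvecs_sum: "(\<And>m. m \<in> S \<Longrightarrow> f m \<in> polyvecs) \<Longrightarrow> sum f S \<in> polyvecs"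
  by (induction S rule: infinite_finite_induct) (auto simp: polyvecs_add polyvecs_zero)

lemma polyvecs_wedge: "U \<in> polyvecs \<Longrightarrow> V \<in> polyvecs \<Longrightarrow> U \<and>\<^sub>P V \<in> polyvecs"
  unfolding polyvecs_def wedge_def
  by (auto intro!: real_polynomial_function_sum real_polynomial_function.intros(4))

lemma polyvecs_contract: "U \<in> polyvecs \<Longrightarrow> contract m U \<in> polyvecs"
proof -
  assume U: "U \<in> polyvecs"
  have "real_polynomial_function (contract m U I)" for I
  proof (cases "m \<in> I")
    case True
    then have "contract m U I = (\<lambda>x. 0)" by (auto simp: contract_def)
    then show ?thesis by auto
  next
    case False
    then have "contract m U I = (\<lambda>x. shuffle_sign I {m} * U (insert m I) x)"
      by (auto simp: contract_def)
    then show ?thesis using polyvecs_real_polynomial[OF U] by auto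
  qed
  then show ?thesis by (simp add: polyvecs_def)
qed

lemma polyvecs_pdiff: "U \<in> polyvecs \<Longrightarrow> pdiff m U \<in> polyvecs"
  by (simp add: polyvecs_def pdiff_def real_polynomial_partial)

lemma pure_deg_add: "pure_deg u U \<Longrightarrow> pure_deg u V \<Longrightarrow> pure_deg u (U + V)"
  by (simp add: pure_deg_def)

lemma pure_deg_scale: "pure_deg u U \<Longrightarrow> pure_deg u (c *\<^sub>P U)"
  by (auto simp: pure_deg_def pv_scale_def)

lemma pure_deg_sum: "(\<And>m. m \<in> S \<Longrightarrow> pure_deg u (f m)) \<Longrightarrow> pure_deg u (sum f S)"
  by (induction S rule: infinite_finite_induct) (simp_all add: pure_deg_def)

lemma polyvecs_deg_add: "U \<in> polyvecs_deg u \<Longrightarrow> V \<in> polyvecs_deg u \<Longrightarrow> U + V \<in> polyvecs_deg u"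
  by (auto dest!: polyvecs_deg_pure intro!: polyvecs_degI polyvecs_add pure_deg_add)

lemma polyvecs_deg_scale: "U \<in> polyvecs_deg u \<Longrightarrow> c *\<^sub>P U \<in> polyvecs_deg u"
  by (auto dest!: polyvecs_deg_pure intro!: polyvecs_degI polyvecs_scale pure_deg_scale)

lemma polyvecs_deg_wedge:
  "U \<in> polyvecs_deg u \<Longrightarrow> W \<in> polyvecs_deg w \<Longrightarrow> U \<and>\<^sub>P W \<in> polyvecs_deg (u + w)"
  by (auto dest!: polyvecs_deg_pure intro!: polyvecs_degI polyvecs_wedge pure_wedge)

lemma polyvecs_deg_contract: "U \<in> polyvecs_deg u \<Longrightarrow> contract m U \<in> polyvecs_deg (u - 1)"
  by (auto dest!: polyvecs_deg_pure intro!: polyvecs_degI polyvecs_contract pure_contract)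

lemma polyvecs_deg_pdiff: "U \<in> polyvecs_deg u \<Longrightarrow> pdiff m U \<in> polyvecs_deg u"
  by (auto dest!: polyvecs_deg_pure intro!: polyvecs_degI polyvecs_pdiff pure_pdiff)

lemma polyvecs_deg_sum:
  "(\<And>m. m \<in> S \<Longrightarrow> f m \<in> polyvecs_deg u) \<Longrightarrow> sum f S \<in> polyvecs_deg u"
  by (auto dest!: polyvecs_deg_pure intro!: polyvecs_degI polyvecs_sum pure_deg_sum)

lemma hom_polyvec_polyvecs_deg: "U \<in> hom_polyvec k l \<Longrightarrow> U \<in> polyvecs_deg l"
proof -
  assume U: "U \<in> hom_polyvec k l"
  have "real_polynomial_function (U I)" for I
  proof (cases "int (card I) = l")
    case True
    then have "U I \<in> hom_poly k" using U by (auto simp: hom_polyvec_def)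
    then show ?thesis by (rule hom_poly_polynomial)
  next
    case False
    then have "U I = (\<lambda>x. 0)" using U by (auto simp: hom_polyvec_def)
    then show ?thesis by auto
  qed
  then show ?thesis using U by (auto simp: polyvecs_deg_def polyvecs_def hom_polyvec_def)
qed

lemma polyvec_diff_conv: "U - V = U + (-1) *\<^sub>P V" for U V :: "'n polyvec"
  by (intro ext) (simp add: pv_scale_def)

text \<open>The type of fields is a function type without a vector space structure in the sense of type
  classes, so finite sums have to be pushed through operators known to be linear only on
  polynomial fields.\<close>

lemma polyvec_linear_sum:
  fixes G :: "'n::{finite,linorder} polyvec \<Rightarrow> 'n polyvec"
  assumes lin: "\<And>U V a b. U \<in> polyvecs \<Longrightarrow> V \<in> polyvecs \<Longrightarrow>
      G (a *\<^sub>P U + b *\<^sub>P V) = a *\<^sub>P G U + b *\<^sub>P G V"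
    and f: "\<And>m. m \<in> S \<Longrightarrow> f m \<in> polyvecs"
  shows "G (c *\<^sub>P sum f S) = c *\<^sub>P (\<Sum>m\<in>S. G (f m))"
proof -
  have null: "0 *\<^sub>P U + 0 *\<^sub>P V = 0" for U V :: "'n polyvec"
    by (intro ext) (simp add: pv_scale_def)
  have zero: "G 0 = 0" using lin[OF polyvecs_zero polyvecs_zero, of 0 0] by (simp only: null)
  have "G (sum f S) = (\<Sum>m\<in>S. G (f m))" using f
  proof (induction S rule: infinite_finite_induct)
    case (insert m S)
    have "G (f m + sum f S) = G (f m) + G (sum f S)"
      using lin[of "f m" "sum f S" 1 1] polyvecs_sum[of S f] insert.prems by simp
    moreover have "G (sum f S) = (\<Sum>m\<in>S. G (f m))" using insert by blast
    ultimately show ?case unfolding sum.insert[OF insert.hyps(1,2)] by (simp only:)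
  qed (simp_all add: zero)
  moreover have "c *\<^sub>P U + 0 *\<^sub>P V = c *\<^sub>P U" for U V :: "'n polyvec"
    by (intro ext) (simp add: pv_scale_def)
  ultimately show ?thesis using lin[OF polyvecs_sum[of S f] polyvecs_zero, of c 0] f by simp
qed

section \<open>Uniqueness of the Schouten bracket\<close>

text \<open>The coordinate vector field \<open>\<partial>\<^sub>m\<close>.\<close>

definition coord_field :: "'n \<Rightarrow> 'n polyvec" where
  "coord_field m = (\<lambda>I x. if I = {m} then 1 else 0)"

lemma coord_field_deg: "coord_field m \<in> polyvecs_deg 1"
proof -
  have "real_polynomial_function (coord_field m I)" for I by (auto simp: coord_field_def)
  then show ?thesis
    by (auto simp: polyvecs_deg_def polyvecs_def coord_field_def zero_fun_def)
qed

lemma wedge_coord_field: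
  fixes U :: "'n::{finite,linorder} polyvec"
  shows "(U \<and>\<^sub>P coord_field m) K x =
     (if m \<in> K then shuffle_sign (K - {m}) {m} * U (K - {m}) x else 0)"
proof -
  have eq: "K - I = {m} \<longleftrightarrow> m \<in> K \<and> I = K - {m}" if "I \<in> Pow K" for I
    using that by auto
  have "(U \<and>\<^sub>P coord_field m) K x = (\<Sum>I\<in>Pow K. if I = K - {m} then
      (if m \<in> K then shuffle_sign (K - {m}) {m} * U (K - {m}) x else 0) else 0)"
    unfolding wedge_apply
    by (intro sum.cong refl) (auto simp: coord_field_def eq double_diff)
  then show ?thesis by (simp add: sum.delta)
qed

text \<open>Each index of a basis element \<open>\<partial>\<^sub>K\<close> can be moved to the last place, and \<open>K\<close> has \<open>w\<close> of
  them. For \<open>w > 0\<close> this writes \<open>W\<close> as a sum of products of fields of lower degree with vector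
  fields, which drives the induction in the uniqueness proof.\<close>

lemma sum_contract_wedge_coord_field:
  fixes W :: "'n::{finite,linorder} polyvec"
  assumes "pure_deg w W"
  shows "(\<Sum>m\<in>UNIV. contract m W \<and>\<^sub>P coord_field m) = of_int w *\<^sub>P W"
proof (intro ext)
  fix K x
  have "(\<Sum>m\<in>UNIV. contract m W \<and>\<^sub>P coord_field m) K x = (\<Sum>m\<in>UNIV. if m \<in> K then W K x else 0)"
    unfolding sum_fun_apply wedge_coord_field
    by (intro sum.cong refl) (auto simp: contract_def insert_absorb)
  also have "\<dots> = real (card K) * W K x" by (simp add: sum.If_cases)
  also have "\<dots> = of_int w * W K x"
    using assms by (cases "int (card K) = w") (auto simp: pure_deg_def)
  finally show "(\<Sum>m\<in>UNIV. contract m W \<and>\<^sub>P coord_field m) K x = (of_int w *\<^sub>P W) K x"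
    by (simp add: pv_scale_def)
qed

lemma schouten_formula_bracket:
  "schouten_bracket (schouten_formula :: 'n::{finite,linorder} polyvec \<Rightarrow> _)"
  unfolding schouten_bracket_def
  by (intro conjI allI ballI)
     (auto dest!: polyvecs_deg_pure intro: schouten_formula_linear schouten_formula_lie
       schouten_formula_functions schouten_formula_antisym schouten_formula_leibniz)

text \<open>Induction on the degree of the second argument: contracting lowers the degree, and the Leibniz
  rule handles the product with a coordinate field.\<close>

lemma schouten_brackets_agree_by_degree:
  fixes br br' :: "'n::{finite,linorder} polyvec \<Rightarrow> 'n polyvec \<Rightarrow> 'n polyvec"
  assumes br: "schouten_bracket br" and br': "schouten_bracket br'"
    and U: "U \<in> polyvecs_deg u"
    and on_functions: "\<And>f. f \<in> polyvecs_deg 0 \<Longrightarrow> br U f = br' U f"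
    and on_fields: "\<And>X. X \<in> polyvecs_deg 1 \<Longrightarrow> br U X = br' U X"
    and W: "W \<in> polyvecs_deg w"
  shows "br U W = br' U W"
proof (cases "w < 0")
  case True
  then have "W I = 0" for I using W by (auto simp: polyvecs_deg_def)
  then have "W \<in> polyvecs_deg 0" using W by (simp add: polyvecs_deg_def)
  then show ?thesis by (rule on_functions)
next
  case False
  have step: "br U W = br' U W" if "W \<in> polyvecs_deg (int d)" for d W
    using that
  proof (induction d arbitrary: W)
    case 0
    then show ?case using on_functions by simp
  next
    case (Suc d)
    let ?S = "\<lambda>m. contract m W \<and>\<^sub>P coord_field m"
    have c: "contract m W \<in> polyvecs_deg (int d)" for m
      using polyvecs_deg_contract[OF Suc.prems, of m] by simp
    have S: "?S m \<in> polyvecs" for m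
      using polyvecs_wedge[OF c[THEN polyvecs_deg_polyvecs]
          coord_field_deg[THEN polyvecs_deg_polyvecs]] .
    have "sum ?S UNIV = of_int (int (Suc d)) *\<^sub>P W"
      by (rule sum_contract_wedge_coord_field[OF polyvecs_deg_pure_deg[OF Suc.prems]])
    then have W: "W = (1 / real (Suc d)) *\<^sub>P sum ?S UNIV" by simp
    have eq: "br U (?S m) = br' U (?S m)" for m
    proof -
      have "b U (?S m) = b U (contract m W) \<and>\<^sub>P coord_field m +
          ((-1) powi ((u - 1) * int d)) *\<^sub>P (contract m W \<and>\<^sub>P b U (coord_field m))"
        if "schouten_bracket b" for b
        using that U c[of m] coord_field_deg[of m] unfolding schouten_bracket_def by blast
      from this[OF br] this[OF br'] show ?thesis
        using Suc.IH[OF c] on_fields[OF coord_field_deg] by simp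
    qed
    have lin: "b U W = (1 / real (Suc d)) *\<^sub>P (\<Sum>m\<in>UNIV. b U (?S m))" if b: "schouten_bracket b" for b
    proof -
      have "b U (a *\<^sub>P V + a' *\<^sub>P V') = a *\<^sub>P b U V + a' *\<^sub>P b U V'"
        if "V \<in> polyvecs" "V' \<in> polyvecs" for a a' V V'
        using b that polyvecs_deg_polyvecs[OF U] unfolding schouten_bracket_def by blast
      from polyvec_linear_sum[where G = "b U" and S = UNIV and f = ?S and c = "1 / real (Suc d)", OF this S]
      show ?thesis using W by simp
    qed
    show ?case unfolding lin[OF br] lin[OF br'] eq ..
  qed
  from step[of W "nat w"] W False show ?thesis by simp
qed

text \<open>Brackets with a vector field are Lie derivatives, on either side by antisymmetry. The degree
  induction is used twice: with a function in the first place it fixes the bracket of functions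
  with all fields, and with this known it fixes the bracket of two arbitrary fields.\<close>

lemma schouten_bracket_unique:
  fixes br br' :: "'n::{finite,linorder} polyvec \<Rightarrow> 'n polyvec \<Rightarrow> 'n polyvec"
  assumes br: "schouten_bracket br" and br': "schouten_bracket br'"
    and U: "U \<in> polyvecs_deg u" and W: "W \<in> polyvecs_deg w"
  shows "br U W = br' U W"
proof -
  have antisym: "b V Z = (- ((-1) powi ((v - 1) * (z - 1)))) *\<^sub>P b Z V"
    if "schouten_bracket b" "V \<in> polyvecs_deg v" "Z \<in> polyvecs_deg z" for b v z and V Z :: "'n polyvec"
    using that unfolding schouten_bracket_def by blast
  have on_field: "br X V = br' X V" if "X \<in> polyvecs_deg 1" "V \<in> polyvecs" for X V :: "'n polyvec"
    using that br br' unfolding schouten_bracket_def by metis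
  have on_field': "br V X = br' V X" if "X \<in> polyvecs_deg 1" "V \<in> polyvecs_deg v" for v and X V :: "'n polyvec"
    using antisym[OF br that(2,1)] antisym[OF br' that(2,1)]
      on_field[OF that(1) polyvecs_deg_polyvecs[OF that(2)]] by simp
  have on_function: "br f V = br' f V" if f: "f \<in> polyvecs_deg 0" and "V \<in> polyvecs_deg v" for v and f V :: "'n polyvec"
  proof (rule schouten_brackets_agree_by_degree[OF br br' f _ _ that(2)])
    fix g :: "'n polyvec" assume "g \<in> polyvecs_deg 0"
    then show "br f g = br' f g" using f br br' unfolding schouten_bracket_def by metis
  qed (use on_field' f in blast)
  have on_function': "br V f = br' V f" if "f \<in> polyvecs_deg 0" "V \<in> polyvecs_deg v" for v and f V :: "'n polyvec"
    using antisym[OF br that(2,1)] antisym[OF br' that(2,1)] on_function[OF that] by simp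
  show ?thesis
    by (rule schouten_brackets_agree_by_degree[OF br br' U on_function'[OF _ U] on_field'[OF _ U] W])
qed

section \<open>The trace operator and the bracket\<close>

lemma contract_pdiff:
  assumes "U \<in> polyvecs"
  shows "contract m (pdiff k U) = pdiff k (contract m U)"
proof (intro ext)
  fix I x
  show "contract m (pdiff k U) I x = pdiff k (contract m U) I x"
  proof (cases "m \<in> I")
    case True
    then have "contract m U I = (\<lambda>x. 0)" by (auto simp: contract_def)
    with True show ?thesis by (simp add: contract_def pdiff_def partial_const)
  next
    case False
    then have "contract m U I = (\<lambda>x. shuffle_sign I {m} * U (insert m I) x)"
      by (auto simp: contract_def)
    with False show ?thesis
      by (simp add: pdiff_def partial_scale polyvecs_real_polynomial[OF assms])
         (simp add: contract_def)
  qed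
qed

lemma contract_anticommute: "contract m (contract k U) = (-1) *\<^sub>P contract k (contract m U)"
proof (intro ext)
  fix I x
  show "contract m (contract k U) I x = ((-1) *\<^sub>P contract k (contract m U)) I x"
  proof (cases "m \<in> I \<or> k \<in> I \<or> m = k")
    case True
    then show ?thesis by (auto simp: contract_def pv_scale_def)
  next
    case False
    have sg: "shuffle_sign (insert a I) {b} = shuffle_sign {a} {b} * shuffle_sign I {b}"
      if "a \<notin> I" for a b
      using shuffle_sign_union_left[of "{a}" I "{b}"] that by simp
    have "shuffle_sign {k} {m} = - shuffle_sign {m} {k}"
      using False by (auto simp: shuffle_sign_def)
    with False show ?thesis
      by (auto simp: contract_def pv_scale_def sg insert_commute)
  qed
qed

lemma pdiff_commute:
  assumes "U \<in> polyvecs"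
  shows "pdiff m (pdiff k U) = pdiff k (pdiff m U)"
  by (intro ext) (simp add: pdiff_def partial_commute[OF polyvecs_real_polynomial[OF assms], of m k])

lemma pdiff_sum:
  fixes f :: "'a \<Rightarrow> 'n::{finite,linorder} polyvec"
  assumes "\<And>j. j \<in> S \<Longrightarrow> f j \<in> polyvecs"
  shows "pdiff m (sum f S) = (\<Sum>j\<in>S. pdiff m (f j))"
  using polyvec_linear_sum[of "pdiff m" S f 1, OF pdiff_linear assms] by simp

lemma contract_sum: "contract m (sum f S) = (\<Sum>j\<in>S. contract m (f j))"
  by (intro ext) (simp add: contract_def sum_fun_apply sum_distrib_left)

text \<open>With anticommuting variables \<open>\<theta>\<^sub>m\<close> in place of the coordinate fields, \<open>contract m\<close> is the
  derivative with respect to \<open>\<theta>\<^sub>m\<close> (acting from the right), so the trace is the odd Laplacian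
  \<open>\<Sum>\<^sub>m \<partial>\<^sup>2 / \<partial>x\<^sup>m \<partial>\<theta>\<^sub>m\<close>.\<close>

lemma trace_op_eq: "trace_op U = (\<Sum>m\<in>UNIV. pdiff m (contract m U))"
proof (intro ext)
  fix I x
  have "component U (sorted_list_of_set I @ [m]) = contract m U I" for m
    by (intro ext) (simp add: component_snoc)
  then show "trace_op U I x = (\<Sum>m\<in>UNIV. pdiff m (contract m U)) I x"
    by (simp add: trace_op_def sum_fun_apply pdiff_def)
qed

lemma polyvecs_deg_trace: "U \<in> polyvecs_deg u \<Longrightarrow> trace_op U \<in> polyvecs_deg (u - 1)"
  unfolding trace_op_eq by (intro polyvecs_deg_sum polyvecs_deg_pdiff polyvecs_deg_contract)

lemma trace_linear:
  fixes U V :: "'n::{finite,linorder} polyvec"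
  assumes "U \<in> polyvecs" "V \<in> polyvecs"
  shows "trace_op (a *\<^sub>P U + b *\<^sub>P V) = a *\<^sub>P trace_op U + b *\<^sub>P trace_op V"
  using assms
  by (simp add: trace_op_eq contract_add contract_scale pdiff_linear polyvecs_contract
      sum.distrib pv_scale_sum)

lemma trace_scale:
  fixes U :: "'n::{finite,linorder} polyvec"
  assumes "U \<in> polyvecs"
  shows "trace_op (c *\<^sub>P U) = c *\<^sub>P trace_op U"
proof -
  have "c *\<^sub>P V + 0 *\<^sub>P V = c *\<^sub>P V" for V :: "'n polyvec"
    by (intro ext) (simp add: pv_scale_def)
  then show ?thesis using trace_linear[OF assms assms, of c 0] by simp
qed

text \<open>Partial derivatives commute while contractions anticommute, so the double sum changes sign
  when its two indices are exchanged.\<close>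

lemma trace_trace:
  fixes U :: "'n::{finite,linorder} polyvec"
  assumes U: "U \<in> polyvecs"
  shows "trace_op (trace_op U) = 0"
proof -
  let ?T = "\<lambda>m k. pdiff m (pdiff k (contract m (contract k U)))"
  have eq: "trace_op (trace_op U) = (\<Sum>m\<in>UNIV. \<Sum>k\<in>UNIV. ?T m k)"
    unfolding trace_op_eq
    by (simp add: contract_sum pdiff_sum contract_pdiff polyvecs_contract polyvecs_pdiff U)
  have anti: "?T m k = (-1) *\<^sub>P ?T k m" for m k
  proof -
    have "?T m k = pdiff k (pdiff m (contract m (contract k U)))"
      by (rule pdiff_commute) (simp add: polyvecs_contract U)
    also have "\<dots> = pdiff k (pdiff m ((-1) *\<^sub>P contract k (contract m U)))"
      by (subst contract_anticommute) simp
    also have "\<dots> = (-1) *\<^sub>P ?T k m"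
    proof -
      have s: "pdiff j ((-1) *\<^sub>P V) = (-1) *\<^sub>P pdiff j V" if "V \<in> polyvecs" for j and V :: "'n polyvec"
        using polyvec_linear_sum[of "pdiff j" "{V}" "\<lambda>V. V" "-1", OF pdiff_linear] that by simp
      show ?thesis by (simp add: s polyvecs_contract polyvecs_pdiff U)
    qed
    finally show ?thesis .
  qed
  have "trace_op (trace_op U) = (\<Sum>m\<in>UNIV. \<Sum>k\<in>UNIV. (-1) *\<^sub>P ?T k m)"
    unfolding eq using anti by (intro sum.cong refl)
  also have "\<dots> = (\<Sum>k\<in>UNIV. \<Sum>m\<in>UNIV. (-1) *\<^sub>P ?T k m)"
    by (rule sum.swap)
  also have "\<dots> = (-1) *\<^sub>P trace_op (trace_op U)"
    unfolding eq pv_scale_sum ..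
  finally have neg: "trace_op (trace_op U) = (-1) *\<^sub>P trace_op (trace_op U)" .
  have "trace_op (trace_op U) I x = - trace_op (trace_op U) I x" for I x
    using fun_cong[OF fun_cong[OF neg, of I], of x] by (simp add: pv_scale_def)
  then show ?thesis by (intro ext) (simp add: equal_neg_zero)
qed

text \<open>Both \<open>contract m\<close> and \<open>pdiff m\<close> obey a (signed) product rule. In their composite the two mixed
  terms, with one operator on each factor, make up the coordinate formula of the bracket.\<close>

lemma trace_wedge:
  assumes U: "U \<in> polyvecs_deg u" and W: "W \<in> polyvecs_deg w"
  shows "trace_op (U \<and>\<^sub>P W) =
    U \<and>\<^sub>P trace_op W + ((-1) powi w) *\<^sub>P (trace_op U \<and>\<^sub>P W + schouten_formula U W)"
proof -
  note p = polyvecs_deg_polyvecs[OF U] polyvecs_deg_polyvecs[OF W]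
  have term_m: "pdiff m (contract m (U \<and>\<^sub>P W)) =
      U \<and>\<^sub>P pdiff m (contract m W) + ((-1) powi w) *\<^sub>P (pdiff m (contract m U) \<and>\<^sub>P W +
        (contract m U \<and>\<^sub>P pdiff m W + ((-1) powi w) *\<^sub>P (pdiff m U \<and>\<^sub>P contract m W)))" for m
  proof -
    have "pdiff m (contract m (U \<and>\<^sub>P W)) =
        pdiff m (U \<and>\<^sub>P contract m W) + ((-1) powi w) *\<^sub>P pdiff m (contract m U \<and>\<^sub>P W)"
      unfolding contract_wedge[OF polyvecs_deg_pure_deg[OF W]]
      using pdiff_linear[of "U \<and>\<^sub>P contract m W" "contract m U \<and>\<^sub>P W" m 1]
      by (simp add: polyvecs_wedge polyvecs_contract p)
    then show ?thesis
      unfolding pdiff_wedge[OF p(1) polyvecs_contract[OF p(2)]]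
        pdiff_wedge[OF polyvecs_contract[OF p(1)] p(2)]
      by (intro ext) (auto simp: pv_scale_def powi_parity)
  qed
  show ?thesis
    unfolding trace_op_eq term_m schouten_formula_pure[OF polyvecs_deg_pure_deg[OF W]]
    by (simp only: sum.distrib wedge_sum_left wedge_sum_right pv_scale_sum pv_scale_add)
qed

lemma schouten_formula_trace:
  assumes "U \<in> polyvecs_deg u" "W \<in> polyvecs_deg w"
  shows "schouten_formula U W =
    ((-1) powi w) *\<^sub>P (trace_op (U \<and>\<^sub>P W) - U \<and>\<^sub>P trace_op W) - trace_op U \<and>\<^sub>P W"
  unfolding trace_wedge[OF assms] by (intro ext) (auto simp: pv_scale_def powi_parity)

text \<open>Express the bracket through the trace by the previous lemma and apply the trace once more: the
  terms with a double trace vanish, and the two copies of \<open>D U \<and> D W\<close> have opposite signs.\<close>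

lemma trace_schouten_formula:
  fixes U W :: "'n::{finite,linorder} polyvec"
  assumes U: "U \<in> polyvecs_deg u" and W: "W \<in> polyvecs_deg w"
  shows "trace_op (schouten_formula U W) =
    schouten_formula U (trace_op W) - ((-1) powi w) *\<^sub>P schouten_formula (trace_op U) W"
proof -
  note p = polyvecs_deg_polyvecs[OF U] polyvecs_deg_polyvecs[OF W]
    and DU = polyvecs_deg_trace[OF U] and DW = polyvecs_deg_trace[OF W]
  note q = polyvecs_deg_polyvecs[OF DU] polyvecs_deg_polyvecs[OF DW]
  let ?s = "(-1::real) powi w"
  have "schouten_formula U W = ?s *\<^sub>P trace_op (U \<and>\<^sub>P W) +
      (-1) *\<^sub>P (?s *\<^sub>P (U \<and>\<^sub>P trace_op W) + 1 *\<^sub>P (trace_op U \<and>\<^sub>P W))"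
    unfolding schouten_formula_trace[OF U W] by (intro ext) (simp add: pv_scale_def algebra_simps)
  then have "trace_op (schouten_formula U W) = ?s *\<^sub>P trace_op (trace_op (U \<and>\<^sub>P W)) +
      (-1) *\<^sub>P (?s *\<^sub>P trace_op (U \<and>\<^sub>P trace_op W) + 1 *\<^sub>P trace_op (trace_op U \<and>\<^sub>P W))"
    by (simp only: trace_linear polyvecs_add polyvecs_scale polyvecs_wedge p q
        polyvecs_deg_polyvecs[OF polyvecs_deg_trace[OF polyvecs_deg_wedge[OF U W]]])
  then show ?thesis
    unfolding trace_wedge[OF U DW] trace_wedge[OF DU W] trace_trace[OF p(1)] trace_trace[OF p(2)]
      trace_trace[OF polyvecs_wedge[OF p]]
    by (intro ext) (auto simp: pv_scale_def powi_parity wedge_def)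
qed

lemma schouten_formula_leibniz_left:
  assumes U: "U \<in> polyvecs_deg u" and W: "W \<in> polyvecs_deg w" and Z: "Z \<in> polyvecs_deg z"
  shows "schouten_formula (U \<and>\<^sub>P W) Z =
    U \<and>\<^sub>P schouten_formula W Z + ((-1) powi (w * (z - 1))) *\<^sub>P (schouten_formula U Z \<and>\<^sub>P W)"
proof -
  note pure = polyvecs_deg_pure_deg[OF U] polyvecs_deg_pure_deg[OF W] polyvecs_deg_pure_deg[OF Z]
  have "schouten_formula (U \<and>\<^sub>P W) Z =
      (- ((-1) powi ((u + w - 1) * (z - 1)))) *\<^sub>P (schouten_formula Z U \<and>\<^sub>P W +
        ((-1) powi ((z - 1) * u)) *\<^sub>P (U \<and>\<^sub>P schouten_formula Z W))"
    using schouten_formula_antisym[OF pure_wedge[OF pure(1,2)] pure(3)]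
      schouten_formula_leibniz[OF pure(3,1,2) polyvecs_deg_polyvecs[OF U] polyvecs_deg_polyvecs[OF W]]
    by simp
  then show ?thesis
    unfolding schouten_formula_antisym[OF pure(3,1)] schouten_formula_antisym[OF pure(3,2)]
      wedge_scale_left wedge_scale_right pv_scale_add pv_scale_scale
    by (intro ext) (auto simp: pv_scale_def powi_parity)
qed

section \<open>The Euler field\<close>

lemma euler_field_singleton: "euler_field {m} = (\<lambda>x. x $ m)"
  by (intro ext) (simp add: euler_field_def)

lemma euler_field_deg: "(euler_field :: 'n::finite polyvec) \<in> polyvecs_deg 1"
proof -
  have "real_polynomial_function ((euler_field :: 'n polyvec) I)" for I
  proof -
    have "real_polynomial_function (\<lambda>x. if I = {m} then x $ m else 0)" for m :: 'n
      by (cases "I = {m}") (auto intro: real_polynomial_function.intros(1) bounded_linear_vec_nth)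
    then show ?thesis unfolding euler_field_def by auto
  qed
  moreover have "(euler_field :: 'n polyvec) I = 0" if "card I \<noteq> 1" for I
  proof -
    have "I \<noteq> {m}" for m using that by auto
    then show ?thesis by (simp add: euler_field_def zero_fun_def)
  qed
  ultimately show ?thesis
    by (auto simp: polyvecs_deg_def polyvecs_def)
qed

lemma euler_field_wedge_self: "euler_field \<and>\<^sub>P euler_field = 0"
proof (intro ext)
  fix K x
  let ?E = "euler_field :: 'a polyvec"
  have "?E \<and>\<^sub>P ?E = ((-1) powi (1 * 1)) *\<^sub>P (?E \<and>\<^sub>P ?E)"
    by (intro wedge_commute polyvecs_deg_pure_deg euler_field_deg)
  from fun_cong[OF fun_cong[OF this, of K], of x]
  show "(?E \<and>\<^sub>P ?E) K x = 0 K x" by (simp add: pv_scale_def)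
qed

lemma wedge_euler_field_twice: "X \<and>\<^sub>P euler_field \<and>\<^sub>P euler_field = 0"
  by (intro ext) (simp add: wedge_assoc euler_field_wedge_self, simp add: wedge_def)

text \<open>The constant function one, as a field of degree zero.\<close>

definition unit_pv :: "'n polyvec" where
  "unit_pv = (\<lambda>I x. if I = {} then 1 else 0)"

lemma partial_coord: "partial m (\<lambda>x. x $ m) = (\<lambda>x. 1)"
  by (simp add: partial_linear bounded_linear_vec_nth)

lemma trace_euler_field:
  "trace_op euler_field = (of_nat CARD('n)) *\<^sub>P (unit_pv :: 'n::{finite,linorder} polyvec)"
proof -
  have "pdiff m (contract m euler_field) = (unit_pv :: 'n polyvec)" for m :: 'n
  proof
    fix I :: "'n set"
    show "pdiff m (contract m euler_field) I = unit_pv I"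
    proof (cases "I = {}")
      case True
      have "contract m euler_field {} = (\<lambda>x. x $ m)"
        by (intro ext) (simp add: contract_def euler_field_singleton)
      then show ?thesis using True by (simp add: pdiff_def unit_pv_def partial_coord)
    next
      case False
      have "contract m euler_field I = 0"
        using pure_contract[OF polyvecs_deg_pure_deg[OF euler_field_deg], of m] False
        by (simp add: pure_deg_def)
      then show ?thesis using False by (simp add: pdiff_def unit_pv_def zero_fun_def partial_const)
    qed
  qed
  then show ?thesis unfolding trace_op_eq
    by (intro ext) (simp add: sum_fun_apply pv_scale_def)
qed

lemma schouten_formula_constant:
  fixes U :: "'n::{finite,linorder} polyvec"
  shows "schouten_formula (c *\<^sub>P unit_pv) U = 0"
proof -
  have "contract m (c *\<^sub>P unit_pv) = 0" for m :: 'n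
    by (intro ext) (simp add: contract_def unit_pv_def pv_scale_def)
  moreover have "pdiff m (c *\<^sub>P unit_pv) = 0" for m :: 'n
    by (intro ext) (simp add: pdiff_def unit_pv_def pv_scale_def partial_const)
  ultimately have "schouten_formula (c *\<^sub>P unit_pv) U = (\<Sum>m\<in>UNIV. 0 \<and>\<^sub>P pdiff m U + 0 \<and>\<^sub>P contract m (grade_inv U))"
    unfolding schouten_formula_def by (simp only:)
  then show ?thesis
    by (intro ext) (simp add: wedge_def sum_fun_apply)
qed

text \<open>For a homogeneous field the weight is the degree of its coefficients minus the number of its
  indices. Recording only this eigenvalue, instead of homogeneity, makes stability under the trace
  a consequence of the derivation property of \<open>D\<close>.\<close>

definition has_weight :: "real \<Rightarrow> 'n::{finite,linorder} polyvec \<Rightarrow> bool" where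
  "has_weight d U \<longleftrightarrow> schouten_formula euler_field U = d *\<^sub>P U"

text \<open>In the Lie derivative along the Euler field the transport term is \<open>k\<close> by Euler's identity, and
  each of the \<open>l\<close> indices contributes \<open>-1\<close>.\<close>

lemma hom_polyvec_weight:
  fixes U :: "'n::{finite,linorder} polyvec"
  assumes U: "U \<in> hom_polyvec k l"
  shows "has_weight (of_int (k - l)) U"
  unfolding has_weight_def schouten_formula_lie[OF polyvecs_deg_pure_deg[OF euler_field_deg]]
proof (intro ext)
  fix I :: "'n set" and x
  define js where "js = sorted_list_of_set I"
  have len: "length js = card I" by (simp add: js_def)
  have comp: "component U js x = U I x"
    by (simp add: component_def js_def inversions_sorted)
  have partial_coord': "partial m (\<lambda>x. x $ i) x = (if m = i then 1 else 0)" for m i :: 'n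
    by (simp add: partial_linear bounded_linear_vec_nth axis_def)
  have "(\<Sum>s<length js. \<Sum>m\<in>UNIV. partial m (euler_field {js ! s}) x * component U (js[s := m]) x)
      = (\<Sum>s<length js. U I x)"
    by (intro sum.cong refl)
       (simp add: euler_field_singleton partial_coord' if_distrib[of "\<lambda>t. t * _"] sum.delta comp cong: if_cong)
  then have "lie euler_field U I x = (\<Sum>m\<in>UNIV. x $ m * partial m (U I) x) - card I * U I x"
    by (simp add: lie_def js_def[symmetric] len euler_field_singleton)
  also have "\<dots> = (of_int (k - l) *\<^sub>P U) I x"
  proof (cases "int (card I) = l")
    case True
    then have "U I \<in> hom_poly k" using U by (auto simp: hom_polyvec_def)
    from hom_poly_euler[OF this, of x] True show ?thesis
      by (auto simp: pv_scale_def algebra_simps)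
  next
    case False
    then have "U I = 0" using U by (auto simp: hom_polyvec_def)
    then show ?thesis by (simp add: pv_scale_def)
  qed
  finally show "lie euler_field U I x = (of_int (k - l) *\<^sub>P U) I x" .
qed

text \<open>In \<open>D [e\<^sub>0, U]\<close> the term \<open>[D e\<^sub>0, U]\<close> drops out, since \<open>D e\<^sub>0\<close> is a constant function.\<close>

lemma has_weight_trace:
  assumes U: "U \<in> polyvecs_deg u" and d: "has_weight d U"
  shows "has_weight d (trace_op U)"
proof -
  have "d *\<^sub>P trace_op U = schouten_formula euler_field (trace_op U) - ((-1) powi u) *\<^sub>P 0"
    using trace_schouten_formula[OF euler_field_deg U] d
    unfolding has_weight_def trace_euler_field schouten_formula_constant
    by (simp only: trace_scale[OF polyvecs_deg_polyvecs[OF U]])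
  also have "\<dots> = schouten_formula euler_field (trace_op U)"
    by (intro ext) (simp add: pv_scale_def)
  finally show ?thesis by (simp add: has_weight_def)
qed

lemma has_weight_wedge_euler_field:
  assumes U: "U \<in> polyvecs_deg u" and d: "has_weight d U"
  shows "has_weight d (U \<and>\<^sub>P euler_field)"
proof -
  note E = polyvecs_deg_pure_deg[OF euler_field_deg]
  have self: "schouten_formula euler_field euler_field = (0 :: 'a polyvec)"
  proof (intro ext)
    fix K x
    from schouten_formula_antisym[OF E E]
    have neg: "schouten_formula euler_field euler_field =
        (-1) *\<^sub>P schouten_formula euler_field (euler_field :: 'a polyvec)" by simp
    from fun_cong[OF fun_cong[OF neg, of K], of x]
    show "schouten_formula euler_field euler_field K x = (0 :: 'a polyvec) K x"
      by (simp add: pv_scale_def)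
  qed
  show ?thesis
    using schouten_formula_leibniz[OF E polyvecs_deg_pure_deg[OF U] E
        polyvecs_deg_polyvecs[OF U] polyvecs_deg_polyvecs[OF euler_field_deg]] d
    unfolding has_weight_def self
    by (intro ext) (simp add: wedge_scale_left, simp add: wedge_def pv_scale_def)
qed

lemma has_weight_linear:
  assumes "U \<in> polyvecs" "V \<in> polyvecs" "has_weight d U" "has_weight d V"
  shows "has_weight d (a *\<^sub>P U + b *\<^sub>P V)"
  using assms unfolding has_weight_def
  by (simp add: schouten_formula_linear pv_scale_add mult.commute)

text \<open>Products with the Euler field stay explicit under the bracket: the Leibniz rule leaves only
  brackets with \<open>e\<^sub>0\<close> itself, which are multiplications by the weight. If both arguments have a
  factor \<open>e\<^sub>0\<close>, then \<open>e\<^sub>0 \<and> e\<^sub>0 = 0\<close> removes the bracket of the other factors.\<close>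

lemma schouten_formula_wedge_euler_right:
  assumes U: "U \<in> polyvecs_deg u" and W: "W \<in> polyvecs_deg w" and d: "has_weight d U"
  shows "schouten_formula U (W \<and>\<^sub>P euler_field) =
    schouten_formula U W \<and>\<^sub>P euler_field - (d * (-1) powi w) *\<^sub>P (U \<and>\<^sub>P W)"
proof -
  note pure = polyvecs_deg_pure_deg[OF U] polyvecs_deg_pure_deg[OF W]
    polyvecs_deg_pure_deg[OF euler_field_deg]
  have UE: "schouten_formula U euler_field = (- d) *\<^sub>P U"
    using schouten_formula_antisym[OF pure(1,3)] d by (simp add: has_weight_def)
  show ?thesis
    unfolding schouten_formula_leibniz[OF pure polyvecs_deg_polyvecs[OF W]
        polyvecs_deg_polyvecs[OF euler_field_deg]] UE wedge_scale_right
      wedge_commute[OF pure(2,1)] pv_scale_scale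
    by (intro ext) (auto simp: pv_scale_def powi_parity)
qed

lemma schouten_formula_wedge_euler_left:
  assumes U: "U \<in> polyvecs_deg u" and W: "W \<in> polyvecs_deg w" and d: "has_weight d W"
  shows "schouten_formula (U \<and>\<^sub>P euler_field) W =
    d *\<^sub>P (U \<and>\<^sub>P W) - ((-1) powi w) *\<^sub>P (schouten_formula U W \<and>\<^sub>P euler_field)"
  unfolding schouten_formula_leibniz_left[OF U euler_field_deg W]
    d[unfolded has_weight_def] wedge_scale_right
  by (intro ext) (auto simp: pv_scale_def powi_parity)

lemma schouten_formula_wedge_euler_both:
  assumes U: "U \<in> polyvecs_deg u" and W: "W \<in> polyvecs_deg w"
    and d: "has_weight d U" and d': "has_weight d' W"
  shows "schouten_formula (U \<and>\<^sub>P euler_field) (W \<and>\<^sub>P euler_field) =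
    (d' - d) *\<^sub>P (U \<and>\<^sub>P W \<and>\<^sub>P euler_field)"
proof -
  have "schouten_formula U (W \<and>\<^sub>P euler_field) \<and>\<^sub>P euler_field =
     (- (d * (-1) powi w)) *\<^sub>P (U \<and>\<^sub>P W \<and>\<^sub>P euler_field)"
    unfolding schouten_formula_wedge_euler_right[OF U W d] polyvec_diff_conv wedge_add_left
      wedge_scale_left wedge_euler_field_twice by (simp add: pv_scale_def fun_eq_iff)
  then show ?thesis
    unfolding schouten_formula_wedge_euler_left[OF U polyvecs_deg_wedge[OF W euler_field_deg]
        has_weight_wedge_euler_field[OF W d']]
    by (intro ext) (auto simp: pv_scale_def powi_parity wedge_assoc algebra_simps)
qed

section \<open>The bracket of decomposed fields\<close>

theorem theorem3p5:
  fixes br :: "'n::{finite,linorder} polyvec \<Rightarrow> 'n polyvec \<Rightarrow> 'n polyvec"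
    and A B A0 B0 :: "'n polyvec"
    and n k l k' l' k'' l'' \<Delta> \<Delta>' \<Delta>'' :: int
  assumes "schouten_bracket br"
    and "n = int CARD('n)"
    and "A \<in> hom_polyvec k l" and "B \<in> hom_polyvec k' l'"
    and "A = A0 + trace_op A \<and>\<^sub>P e_field k l" and "trace_op A0 = 0"
    and "B = B0 + trace_op B \<and>\<^sub>P e_field k' l'" and "trace_op B0 = 0"
    and "\<Delta> = k - l" and "\<Delta>' = k' - l'"
    and "k'' = k + k'" and "l'' = l + l'" and "\<Delta>'' = \<Delta> + \<Delta>'"
    and "n + \<Delta> \<noteq> 0" and "n + \<Delta>' \<noteq> 0" and "n + \<Delta>'' \<noteq> 0"
  shows "br A B - trace_op (br A B) \<and>\<^sub>P e_field k'' l'' =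
           br A0 B0
           + (of_int \<Delta>' / of_int (n + \<Delta>)) *\<^sub>P (trace_op A \<and>\<^sub>P B0)
           + ((-1) powi l' * (of_int \<Delta> / of_int (n + \<Delta>'))) *\<^sub>P (A0 \<and>\<^sub>P trace_op B)
           + (of_int \<Delta> / of_int (n + \<Delta>')) *\<^sub>P (br A0 (trace_op B) \<and>\<^sub>P e_field k'' l'')
           - ((-1) powi l' * (of_int \<Delta>' / of_int (n + \<Delta>)))
               *\<^sub>P (br (trace_op A) B0 \<and>\<^sub>P e_field k'' l'')
       \<and> trace_op (br A B) =
           br A0 (trace_op B) - ((-1) powi l') *\<^sub>P br (trace_op A) B0
           - (of_int ((n + \<Delta>'') * (\<Delta> - \<Delta>')) / of_int ((n + \<Delta>) * (n + \<Delta>')))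
               *\<^sub>P (trace_op A \<and>\<^sub>P trace_op B
                   + ((-1) powi l') *\<^sub>P (br (trace_op A) (trace_op B) \<and>\<^sub>P e_field k'' l''))"
proof -
  define E where "E = (euler_field :: 'n polyvec)"
  define P where "P = trace_op A"
  define Q where "Q = trace_op B"
  define N d d' s :: real where "N = of_int n" and "d = of_int \<Delta>" and "d' = of_int \<Delta>'"
    and "s = (-1) powi l'"
  define a b c where "a = 1 / (N + d)" and "b = 1 / (N + d')" and "c = 1 / (N + d + d')"
  have nz: "N + d \<noteq> 0" "N + d' \<noteq> 0" "N + d + d' \<noteq> 0"
    using assms(13-16) unfolding N_def d_def d'_def
    by (metis add.assoc of_int_add of_int_eq_0_iff)+
  have e: "e_field k l = a *\<^sub>P E" "e_field k' l' = b *\<^sub>P E" "e_field k'' l'' = c *\<^sub>P E"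
    by (simp_all add: e_field_def E_def a_def b_def c_def N_def d_def d'_def assms(2,9-12) algebra_simps)
  have A: "A = 1 *\<^sub>P A0 + a *\<^sub>P (P \<and>\<^sub>P E)" and B: "B = 1 *\<^sub>P B0 + b *\<^sub>P (Q \<and>\<^sub>P E)"
    using assms(5,7) by (simp_all add: e P_def Q_def wedge_scale_right)

  have degE: "E \<in> polyvecs_deg 1" unfolding E_def by (rule euler_field_deg)
  have degA: "A \<in> polyvecs_deg l" and degB: "B \<in> polyvecs_deg l'"
    using assms(3,4) by (auto intro: hom_polyvec_polyvecs_deg)
  have degP: "P \<in> polyvecs_deg (l - 1)" and degQ: "Q \<in> polyvecs_deg (l' - 1)"
    unfolding P_def Q_def by (intro polyvecs_deg_trace degA degB)+
  have degPE: "P \<and>\<^sub>P E \<in> polyvecs_deg l" and degQE: "Q \<and>\<^sub>P E \<in> polyvecs_deg l'"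
    using polyvecs_deg_wedge[OF degP degE] polyvecs_deg_wedge[OF degQ degE] by simp_all
  have A0: "A0 = 1 *\<^sub>P A + (- a) *\<^sub>P (P \<and>\<^sub>P E)" and B0: "B0 = 1 *\<^sub>P B + (- b) *\<^sub>P (Q \<and>\<^sub>P E)"
    unfolding A B by (intro ext, simp add: pv_scale_def)+
  have degA0: "A0 \<in> polyvecs_deg l"
    unfolding A0 by (intro polyvecs_deg_add polyvecs_deg_scale degA degPE)
  have degB0: "B0 \<in> polyvecs_deg l'"
    unfolding B0 by (intro polyvecs_deg_add polyvecs_deg_scale degB degQE)

  have wA: "has_weight d A" and wB: "has_weight d' B"
    using hom_polyvec_weight[OF assms(3)] hom_polyvec_weight[OF assms(4)] assms(9,10)
    by (simp_all add: d_def d'_def)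
  have wP: "has_weight d P" and wQ: "has_weight d' Q"
    unfolding P_def Q_def by (rule has_weight_trace[OF degA wA], rule has_weight_trace[OF degB wB])
  have wA0: "has_weight d A0"
    unfolding A0 E_def by (intro has_weight_linear has_weight_wedge_euler_field[OF degP] wA wP
        polyvecs_deg_polyvecs[OF degA] polyvecs_deg_polyvecs[OF degPE[unfolded E_def]])
  have wB0: "has_weight d' B0"
    unfolding B0 E_def by (intro has_weight_linear has_weight_wedge_euler_field[OF degQ] wB wQ
        polyvecs_deg_polyvecs[OF degB] polyvecs_deg_polyvecs[OF degQE[unfolded E_def]])

  \<comment> \<open>From here on only the coordinate formula occurs.\<close>
  have br: "br U W = schouten_formula U W" if "U \<in> polyvecs_deg u" "W \<in> polyvecs_deg w" for U W u w
    by (rule schouten_bracket_unique[OF assms(1) schouten_formula_bracket that])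
  note br_eqs = br[OF degA degB] br[OF degA0 degB0] br[OF degA0 degQ] br[OF degP degB0] br[OF degP degQ]
  let ?F = "schouten_formula :: 'n polyvec \<Rightarrow> _"

  have sgn: "(-1::real) powi (l' - 1) = - s" unfolding s_def by (auto simp: powi_parity)
  have s2: "s * s = 1" unfolding s_def by (auto simp: powi_parity)
  note pA = polyvecs_deg_polyvecs[OF degA0] polyvecs_deg_polyvecs[OF degPE]
    and pB = polyvecs_deg_polyvecs[OF degB0] polyvecs_deg_polyvecs[OF degQE]

  have bracket: "?F A B = ?F A0 B0 + b *\<^sub>P (?F A0 Q \<and>\<^sub>P E + (d * s) *\<^sub>P (A0 \<and>\<^sub>P Q))
      + a *\<^sub>P (d' *\<^sub>P (P \<and>\<^sub>P B0) - s *\<^sub>P (?F P B0 \<and>\<^sub>P E))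
      + (a * b * (d' - d)) *\<^sub>P (P \<and>\<^sub>P Q \<and>\<^sub>P E)"
    unfolding A B schouten_formula_linear[OF pA] schouten_formula_linear[OF pB]
      schouten_formula_wedge_euler_right[OF degA0 degQ wA0, folded E_def, unfolded sgn]
      schouten_formula_wedge_euler_left[OF degP degB0 wB0, folded E_def s_def]
      schouten_formula_wedge_euler_both[OF degP degQ wP wQ, folded E_def]
    by (intro ext) (simp add: pv_scale_def algebra_simps)

  \<comment> \<open>\<open>\<kappa>\<close> is the coefficient of the last term of \<open>D [A, B]\<close>. The identities below bring the
    coefficients that the expansions produce into the stated form.\<close>
  define \<kappa> where "\<kappa> = (N + d + d') * (d - d') * a * b"
  have coeff_wedge: "a * d' - b * d = - \<kappa>"
    using nz unfolding \<kappa>_def a_def b_def by (simp add: divide_simps) algebra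
  have coeff_bracket: "a - b = - \<kappa> * c"
    using nz unfolding \<kappa>_def a_def b_def c_def by (simp add: divide_simps)
  have coeff_A0: "b - c = d * b * c" and coeff_B0: "a - c = d' * a * c"
    and coeff_top: "\<kappa> * c = (d - d') * a * b"
    using nz unfolding \<kappa>_def a_def b_def c_def by (simp_all add: divide_simps)

  have "trace_op (?F A B) = ?F A Q - s *\<^sub>P ?F P B"
    using trace_schouten_formula[OF degA degB] unfolding P_def Q_def s_def .
  also have "\<dots> = ?F A0 Q - s *\<^sub>P ?F P B0 + (a * d' - b * d) *\<^sub>P (P \<and>\<^sub>P Q)
      + (s * (a - b)) *\<^sub>P (?F P Q \<and>\<^sub>P E)"
    unfolding A B schouten_formula_linear[OF pA] schouten_formula_linear[OF pB]
      schouten_formula_wedge_euler_right[OF degP degQ wP, folded E_def, unfolded sgn]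
      schouten_formula_wedge_euler_left[OF degP degQ wQ, folded E_def, unfolded sgn]
    using s2 by (intro ext) (simp add: pv_scale_def algebra_simps)
  finally have trace: "trace_op (?F A B) = ?F A0 Q - s *\<^sub>P ?F P B0 - \<kappa> *\<^sub>P (P \<and>\<^sub>P Q)
      - (s * \<kappa> * c) *\<^sub>P (?F P Q \<and>\<^sub>P E)"
    unfolding coeff_wedge coeff_bracket by (simp add: pv_scale_def fun_eq_iff)
  have EE: "X \<and>\<^sub>P E \<and>\<^sub>P E = 0" for X
    unfolding E_def by (rule wedge_euler_field_twice)
  have trace_E: "trace_op (?F A B) \<and>\<^sub>P E = ?F A0 Q \<and>\<^sub>P E - s *\<^sub>P (?F P B0 \<and>\<^sub>P E)
      - \<kappa> *\<^sub>P (P \<and>\<^sub>P Q \<and>\<^sub>P E)"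
    unfolding trace polyvec_diff_conv wedge_add_left wedge_scale_left EE
    by (intro ext) (simp add: pv_scale_def)

  have first: "?F A B - c *\<^sub>P (trace_op (?F A B) \<and>\<^sub>P E) =
      ?F A0 B0 + (d' * a) *\<^sub>P (P \<and>\<^sub>P B0) + (s * (d * b)) *\<^sub>P (A0 \<and>\<^sub>P Q)
      + (d * b * c) *\<^sub>P (?F A0 Q \<and>\<^sub>P E) - (s * (d' * a * c)) *\<^sub>P (?F P B0 \<and>\<^sub>P E)"
  proof -
    \<comment> \<open>The last coefficient vanishes by \<open>coeff_top\<close>.\<close>
    have "?F A B - c *\<^sub>P (trace_op (?F A B) \<and>\<^sub>P E) =
      ?F A0 B0 + (d' * a) *\<^sub>P (P \<and>\<^sub>P B0) + (s * (d * b)) *\<^sub>P (A0 \<and>\<^sub>P Q)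
      + (b - c) *\<^sub>P (?F A0 Q \<and>\<^sub>P E) - (s * (a - c)) *\<^sub>P (?F P B0 \<and>\<^sub>P E)
      + (\<kappa> * c - (d - d') * a * b) *\<^sub>P (P \<and>\<^sub>P Q \<and>\<^sub>P E)"
      unfolding trace_E unfolding bracket by (intro ext) (simp add: pv_scale_def algebra_simps)
    then show ?thesis
      unfolding coeff_A0 coeff_B0 coeff_top by (simp add: pv_scale_def fun_eq_iff)
  qed

  have coeffs: "of_int \<Delta>' / of_int (n + \<Delta>) = d' * a" "of_int \<Delta> / of_int (n + \<Delta>') = d * b"
    "of_int ((n + \<Delta>'') * (\<Delta> - \<Delta>')) / of_int ((n + \<Delta>) * (n + \<Delta>')) = \<kappa>"
    using assms(13) by (simp_all add: a_def b_def \<kappa>_def N_def d_def d'_def add.assoc)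
  show ?thesis
    unfolding br_eqs[unfolded P_def Q_def] coeffs e s_def[symmetric] wedge_scale_right
    unfolding P_def[symmetric] Q_def[symmetric]
  proof (intro conjI)
    show "?F A B - c *\<^sub>P (trace_op (?F A B) \<and>\<^sub>P E) = ?F A0 B0 + (d' * a) *\<^sub>P (P \<and>\<^sub>P B0)
        + (s * (d * b)) *\<^sub>P (A0 \<and>\<^sub>P Q) + (d * b) *\<^sub>P c *\<^sub>P (?F A0 Q \<and>\<^sub>P E)
        - (s * (d' * a)) *\<^sub>P c *\<^sub>P (?F P B0 \<and>\<^sub>P E)"
      unfolding first by (simp add: mult.assoc)
    show "trace_op (?F A B) = ?F A0 Q - s *\<^sub>P ?F P B0 -
        \<kappa> *\<^sub>P (P \<and>\<^sub>P Q + s *\<^sub>P c *\<^sub>P (?F P Q \<and>\<^sub>P E))"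
      unfolding trace by (intro ext) (simp add: pv_scale_def algebra_simps)
  qed
qed

end
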